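(* Let $\mathcal{X}$ be a simply-connected (rigid) special Kähler manifold. Then two distinct stable complete geodesics of $\mathcal{X}$ cross at most once (they have at most one common point). In particular there are no closed stable geodesics in $\mathcal{X}$.
   Context: A (rigid, i.e. non-projective) simply-connected special Kähler manifold $\mathcal{X}$ of complex dimension $r$ is a simply-connected complex manifold equipped with holomorphic functions $a^1,\dots,a^r,b_1,\dots,b_r$ (flat symplectic periods) such that $da^1,\dots,da^r$ are linearly independent at every point (so the $a^i$ are local "special coordinates") and $db_i=\sum_j\tau_{ij}\,da^j$ with $(\tau_{ij})$ symmetric with positive-definite imaginary part; locally $b_i=\partial\mathcal{F}/\partial a^i$, $\tau_{ij}=\partial^2\mathcal{F}/\partial a^i\partial a^j$ for a holomorphic prepotential $\mathcal{F}$. It carries the Kähler metric $ds^2=\mathrm{Im}(\tau_{ij})\,da^i\,d\bar a^{\bar j}$, which is not assumed to be complete. Geodesics are parametrized by arc-length (in particular they are non-constant), and are regarded as the same if they have the same image. A geodesic is complete if it can be extended to a geodesic $\gamma\colon(-\infty,+\infty)\to\mathcal{X}$; closed geodesics are in particular complete. A geodesic $\gamma$ is stable between two of its points $p$ and $q$ if the geodesic arc connecting them is locally length-minimizing among all nearby curves joining $p$ and $q$, that is, if the Jacobi operator is positive-definite on the space of normal vector fields along $\gamma$ which vanish at both $p$ and $q$. $\gamma$ is stable if it is stable between all pairs of its points. *)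

theory Defs
  imports "HOL-Analysis.Analysis"
begin

section \<open>Complex manifolds\<close>

type_synonym ('a, 'r) chart = "'a set \<times> ('a \<Rightarrow> complex ^ 'r)"

definition chart_inv :: "('a, 'r) chart \<Rightarrow> complex ^ 'r \<Rightarrow> 'a" where
  "chart_inv c = inv_into (fst c) (snd c)"

text \<open>The differential at \<open>x\<close> of a function on the manifold, read in the chart \<open>c\<close>.\<close>

definition chart_differential ::
  "('a, 'r::finite) chart \<Rightarrow> ('a \<Rightarrow> complex) \<Rightarrow> 'a \<Rightarrow> complex ^ 'r \<Rightarrow> complex" where
  "chart_differential c f x = frechet_derivative (f \<circ> chart_inv c) (at (snd c x))"

definition holomorphic_in_chart_at ::
  "('a, 'r::finite) chart \<Rightarrow> ('a \<Rightarrow> complex) \<Rightarrow> 'a \<Rightarrow> bool" where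
  "holomorphic_in_chart_at c f x \<longleftrightarrow>
     (f \<circ> chart_inv c) differentiable (at (snd c x)) \<and>
     (\<forall>k v. chart_differential c f x (k *s v) = k * chart_differential c f x v)"

locale complex_manifold =
  fixes atlas :: "('a::{t2_space, second_countable_topology}, 'r::finite) chart set"
  assumes chart_homeomorphism:
      "\<And>c. c \<in> atlas \<Longrightarrow> open (fst c) \<and> open (snd c ` fst c) \<and>
             homeomorphism (fst c) (snd c ` fst c) (snd c) (chart_inv c)"
    and charts_cover: "(\<Union>c\<in>atlas. fst c) = UNIV"
    and transition_holomorphic:
      "\<And>c d x k. c \<in> atlas \<Longrightarrow> d \<in> atlas \<Longrightarrow> x \<in> fst c \<inter> fst d \<Longrightarrow>
         holomorphic_in_chart_at c (\<lambda>y. snd d y $ k) x"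
begin

definition holomorphic_function :: "('a \<Rightarrow> complex) \<Rightarrow> bool" where
  "holomorphic_function f \<longleftrightarrow>
     (\<forall>c\<in>atlas. \<forall>x\<in>fst c. holomorphic_in_chart_at c f x)"

end


section \<open>Special Kaehler manifolds\<close>

text \<open>
  The components of \<open>a\<close> and \<open>b\<close> are the flat periods, and \<open>\<tau>\<close> is the period matrix
  \<open>\<partial>b\<^sub>i / \<partial>a\<^sub>j\<close>.
\<close>

locale special_kaehler_manifold = complex_manifold atlas
  for atlas :: "('a::{t2_space, second_countable_topology}, 'r::finite) chart set" +
  fixes a b :: "'a \<Rightarrow> complex ^ 'r"
    and \<tau> :: "'a \<Rightarrow> complex ^ 'r ^ 'r"
  assumes a_holomorphic: "\<And>i. holomorphic_function (\<lambda>x. a x $ i)"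
    and b_holomorphic: "\<And>i. holomorphic_function (\<lambda>x. b x $ i)"
    and da_independent:
      "\<And>c x l. c \<in> atlas \<Longrightarrow> x \<in> fst c \<Longrightarrow>
         (\<forall>v. (\<Sum>i\<in>UNIV. l $ i * chart_differential c (\<lambda>y. a y $ i) x v) = 0) \<Longrightarrow>
         l = (0 :: complex ^ 'r)"
    and db_eq:
      "\<And>c x i v. c \<in> atlas \<Longrightarrow> x \<in> fst c \<Longrightarrow>
         chart_differential c (\<lambda>y. b y $ i) x v =
         (\<Sum>j\<in>UNIV. \<tau> x $ i $ j * chart_differential c (\<lambda>y. a y $ j) x v)"
    and \<tau>_symmetric: "\<And>x i j. \<tau> x $ i $ j = \<tau> x $ j $ i"
    and Im_\<tau>_pos_def:
      "\<And>x (v :: real ^ 'r). v \<noteq> 0 \<Longrightarrow>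
         (\<Sum>i\<in>UNIV. \<Sum>j\<in>UNIV. Im (\<tau> x $ i $ j) * v $ i * v $ j) > 0"


section \<open>Riemannian geometry in local coordinates\<close>

text \<open>A metric \<open>g\<close> assigns to the coordinate point \<open>z\<close> the bilinear form \<open>g z\<close>.\<close>

type_synonym 'v metric = "'v \<Rightarrow> 'v \<Rightarrow> 'v \<Rightarrow> real"

text \<open>
  Christoffel symbols as the vector-valued bilinear form
  \<open>\<Gamma>\<^sub>z(v,w)\<close>, determined by the Koszul formula for constant vector fields.
\<close>

definition christoffel :: "'v::euclidean_space metric \<Rightarrow> 'v \<Rightarrow> 'v \<Rightarrow> 'v \<Rightarrow> 'v" where
  "christoffel g z v w = (THE c. \<forall>u. 2 * g z c u =
       frechet_derivative (\<lambda>y. g y w u) (at z) v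
     + frechet_derivative (\<lambda>y. g y v u) (at z) w
     - frechet_derivative (\<lambda>y. g y v w) (at z) u)"

text \<open>\<open>R(u,v)w = \<nabla>\<^sub>u \<nabla>\<^sub>v w - \<nabla>\<^sub>v \<nabla>\<^sub>u w\<close> for constant vector fields.\<close>

definition curvature :: "'v::euclidean_space metric \<Rightarrow> 'v \<Rightarrow> 'v \<Rightarrow> 'v \<Rightarrow> 'v \<Rightarrow> 'v" where
  "curvature g z u v w =
       frechet_derivative (\<lambda>y. christoffel g y v w) (at z) u
     - frechet_derivative (\<lambda>y. christoffel g y u w) (at z) v
     + christoffel g z u (christoffel g z v w)
     - christoffel g z v (christoffel g z u w)"

definition curve_derivative :: "(real \<Rightarrow> 'v::real_normed_vector) \<Rightarrow> real \<Rightarrow> 'v" where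
  "curve_derivative f t = vector_derivative f (at t)"

definition smooth_curve :: "(real \<Rightarrow> 'v::real_normed_vector) \<Rightarrow> bool" where
  "smooth_curve f \<longleftrightarrow> (\<forall>n t. (curve_derivative ^^ n) f differentiable (at t))"


section \<open>The special Kaehler metric, its geodesics and their stability\<close>

text \<open>
  As the \<open>da\<^sup>i\<close> are pointwise independent, \<open>a\<close> restricts to a holomorphic chart near every
  point, and all the geometry below is computed in these special coordinates.
  A real tangent vector \<open>V\<close> is represented by its components \<open>da\<^sup>i(V)\<close> in \<open>complex ^ 'r\<close>, so
  the almost complex structure is multiplication by \<open>\<i>\<close>.
  Two such charts around a point differ at most in their domains, the transition map being
  the identity; the choice of a chart in \<open>special_inv\<close> is therefore immaterial for the
  values of the derivatives at the point.
\<close>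

definition special_domain :: "('a::topological_space \<Rightarrow> complex ^ 'r::finite) \<Rightarrow> 'a set \<Rightarrow> bool" where
  "special_domain a U \<longleftrightarrow> open U \<and> open (a ` U) \<and> homeomorphism U (a ` U) a (inv_into U a)"

definition special_inv ::
  "('a::topological_space \<Rightarrow> complex ^ 'r::finite) \<Rightarrow> 'a \<Rightarrow> complex ^ 'r \<Rightarrow> 'a" where
  "special_inv a x = inv_into (SOME U. x \<in> U \<and> special_domain a U) a"

text \<open>The real inner product of the Hermitian form \<open>Im \<tau>\<^sub>i\<^sub>j da\<^sup>i d\<bar>a\<^sup>j\<close>.\<close>

definition sk_metric ::
  "('a \<Rightarrow> complex ^ 'r ^ 'r) \<Rightarrow> 'a \<Rightarrow> complex ^ 'r \<Rightarrow> complex ^ 'r::finite \<Rightarrow> real" where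
  "sk_metric \<tau> x v w =
     Re (\<Sum>i\<in>UNIV. \<Sum>j\<in>UNIV. of_real (Im (\<tau> x $ i $ j)) * v $ i * cnj (w $ j))"

definition sk_metric_coord ::
  "('a::topological_space \<Rightarrow> complex ^ 'r::finite) \<Rightarrow> ('a \<Rightarrow> complex ^ 'r ^ 'r) \<Rightarrow> 'a \<Rightarrow>
   (complex ^ 'r) metric" where
  "sk_metric_coord a \<tau> x z = sk_metric \<tau> (special_inv a x z)"

definition sk_christoffel ::
  "('a::topological_space \<Rightarrow> complex ^ 'r::finite) \<Rightarrow> ('a \<Rightarrow> complex ^ 'r ^ 'r) \<Rightarrow> 'a \<Rightarrow>
   complex ^ 'r \<Rightarrow> complex ^ 'r \<Rightarrow> complex ^ 'r" where
  "sk_christoffel a \<tau> x = christoffel (sk_metric_coord a \<tau> x) (a x)"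

definition sk_curvature ::
  "('a::topological_space \<Rightarrow> complex ^ 'r::finite) \<Rightarrow> ('a \<Rightarrow> complex ^ 'r ^ 'r) \<Rightarrow> 'a \<Rightarrow>
   complex ^ 'r \<Rightarrow> complex ^ 'r \<Rightarrow> complex ^ 'r \<Rightarrow> complex ^ 'r" where
  "sk_curvature a \<tau> x = curvature (sk_metric_coord a \<tau> x) (a x)"

definition velocity :: "('a \<Rightarrow> complex ^ 'r::finite) \<Rightarrow> (real \<Rightarrow> 'a) \<Rightarrow> real \<Rightarrow> complex ^ 'r" where
  "velocity a \<gamma> = curve_derivative (a \<circ> \<gamma>)"

text \<open>\<open>D/dt V\<close> along the curve \<open>\<gamma>\<close>.\<close>

definition covariant_derivative ::
  "('a::topological_space \<Rightarrow> complex ^ 'r::finite) \<Rightarrow> ('a \<Rightarrow> complex ^ 'r ^ 'r) \<Rightarrow>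
   (real \<Rightarrow> 'a) \<Rightarrow> (real \<Rightarrow> complex ^ 'r) \<Rightarrow> real \<Rightarrow> complex ^ 'r" where
  "covariant_derivative a \<tau> \<gamma> V t =
     curve_derivative V t + sk_christoffel a \<tau> (\<gamma> t) (velocity a \<gamma> t) (V t)"

definition complete_geodesic ::
  "('a::topological_space \<Rightarrow> complex ^ 'r::finite) \<Rightarrow> ('a \<Rightarrow> complex ^ 'r ^ 'r) \<Rightarrow>
   (real \<Rightarrow> 'a) \<Rightarrow> bool" where
  "complete_geodesic a \<tau> \<gamma> \<longleftrightarrow>
     continuous_on UNIV \<gamma> \<and> smooth_curve (a \<circ> \<gamma>) \<and>
     (\<forall>t. sk_metric \<tau> (\<gamma> t) (velocity a \<gamma> t) (velocity a \<gamma> t) = 1) \<and>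
     (\<forall>t. covariant_derivative a \<tau> \<gamma> (velocity a \<gamma>) t = 0)"

definition closed_geodesic ::
  "('a::topological_space \<Rightarrow> complex ^ 'r::finite) \<Rightarrow> ('a \<Rightarrow> complex ^ 'r ^ 'r) \<Rightarrow>
   (real \<Rightarrow> 'a) \<Rightarrow> bool" where
  "closed_geodesic a \<tau> \<gamma> \<longleftrightarrow>
     complete_geodesic a \<tau> \<gamma> \<and> (\<exists>L>0. \<forall>t. \<gamma> (t + L) = \<gamma> t)"

definition jacobi_operator ::
  "('a::topological_space \<Rightarrow> complex ^ 'r::finite) \<Rightarrow> ('a \<Rightarrow> complex ^ 'r ^ 'r) \<Rightarrow>
   (real \<Rightarrow> 'a) \<Rightarrow> (real \<Rightarrow> complex ^ 'r) \<Rightarrow> real \<Rightarrow> complex ^ 'r" where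
  "jacobi_operator a \<tau> \<gamma> V t =
     - covariant_derivative a \<tau> \<gamma> (covariant_derivative a \<tau> \<gamma> V) t
     - sk_curvature a \<tau> (\<gamma> t) (V t) (velocity a \<gamma> t) (velocity a \<gamma> t)"

text \<open>
  Smooth fields on the arc over \<open>[s,t]\<close> are taken as restrictions of smooth fields on the
  whole line; every smooth field on a compact interval extends in this way.
\<close>

definition normal_field_vanishing_at ::
  "('a \<Rightarrow> complex ^ 'r::finite) \<Rightarrow> ('a \<Rightarrow> complex ^ 'r ^ 'r) \<Rightarrow> (real \<Rightarrow> 'a) \<Rightarrow>
   real \<Rightarrow> real \<Rightarrow> (real \<Rightarrow> complex ^ 'r) \<Rightarrow> bool" where
  "normal_field_vanishing_at a \<tau> \<gamma> s t V \<longleftrightarrow>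
     smooth_curve V \<and> V s = 0 \<and> V t = 0 \<and>
     (\<forall>u\<in>{s..t}. sk_metric \<tau> (\<gamma> u) (V u) (velocity a \<gamma> u) = 0)"

definition stable_between ::
  "('a::topological_space \<Rightarrow> complex ^ 'r::finite) \<Rightarrow> ('a \<Rightarrow> complex ^ 'r ^ 'r) \<Rightarrow>
   (real \<Rightarrow> 'a) \<Rightarrow> real \<Rightarrow> real \<Rightarrow> bool" where
  "stable_between a \<tau> \<gamma> s t \<longleftrightarrow>
     (\<forall>V. normal_field_vanishing_at a \<tau> \<gamma> s t V \<and> (\<exists>u\<in>{s..t}. V u \<noteq> 0) \<longrightarrow>
        integral {s..t} (\<lambda>u. sk_metric \<tau> (\<gamma> u) (jacobi_operator a \<tau> \<gamma> V u) (V u)) > 0)"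

definition stable_geodesic ::
  "('a::topological_space \<Rightarrow> complex ^ 'r::finite) \<Rightarrow> ('a \<Rightarrow> complex ^ 'r ^ 'r) \<Rightarrow>
   (real \<Rightarrow> 'a) \<Rightarrow> bool" where
  "stable_geodesic a \<tau> \<gamma> \<longleftrightarrow>
     complete_geodesic a \<tau> \<gamma> \<and> (\<forall>s t. s < t \<longrightarrow> stable_between a \<tau> \<gamma> s t)"

end

theory Submission
  imports Defs "HOL-Complex_Analysis.Cauchy_Integral_Formula"
begin

text \<open>
  The metric \<open>Im \<tau>\<close> is nonnegatively curved along complex lines: in special coordinates
  \<open>\<Gamma>(v,v)\<close> is determined by \<open>Im \<tau> \<cdot> \<Gamma>(v,v) = -(\<i>/2) \<partial>\<^sub>v\<tau> v\<close>, and the holomorphic sectional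
  curvature is \<open>g(R(Jv,v)v, Jv) = 2 g(\<Gamma>(v,v), \<Gamma>(v,v))\<close>. For a stable complete geodesic
  \<open>\<gamma>\<close> the field \<open>J\<gamma>'\<close> is parallel and normal; multiplying it by
  \<open>cos (\<pi>t/2T)\<close> on \<open>[-T,T]\<close> and letting \<open>T \<rightarrow> \<infinity>\<close> forces this curvature, hence \<open>\<Gamma>(\<gamma>',\<gamma>')\<close>, to
  vanish along \<open>\<gamma>\<close>. So the geodesic equation reads \<open>(a \<circ> \<gamma>)'' = 0\<close>: a stable complete
  geodesic is a straight line in the period coordinates. Two such lines through the same two
  distinct points have the same unit velocity up to sign, and the local injectivity of
  \<open>a\<close> then makes the geodesics agree; a closed line would have velocity \<open>0\<close>.
\<close>

section \<open>Holomorphic functions of several variables\<close>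

text \<open>The body of \<open>holomorphic_in_chart_at\<close> transcribed to coordinate space, so
  that the manifold hypotheses unfold into it. Complex linearity of the real differential is the
  Cauchy-Riemann system.\<close>

definition complex_differentiable_at :: "(complex ^ 'n::finite \<Rightarrow> complex) \<Rightarrow> complex ^ 'n \<Rightarrow> bool" where
  "complex_differentiable_at f z \<longleftrightarrow> f differentiable (at z) \<and>
     (\<forall>k v. frechet_derivative f (at z) (k *s v) = k * frechet_derivative f (at z) v)"

lemma complex_differentiable_atD:
  assumes "complex_differentiable_at f z"
  shows "(f has_derivative frechet_derivative f (at z)) (at z)"
    and "frechet_derivative f (at z) (k *s v) = k * frechet_derivative f (at z) v"
    and "linear (frechet_derivative f (at z))"
  using assms by (auto simp: complex_differentiable_at_def frechet_derivative_works
      intro: linear_frechet_derivative)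

lemma complex_differentiable_atI:
  assumes "(f has_derivative f') (at z)" and "\<And>k v. f' (k *s v) = k * f' v"
  shows "complex_differentiable_at f z"
  using assms frechet_derivative_at[OF assms(1)]
  unfolding complex_differentiable_at_def differentiable_def by auto

section \<open>Complex scaling of vectors and restriction to complex lines\<close>

lemma scaleR_eq_vector_smult: "r *\<^sub>R (v :: complex ^ 'n) = of_real r *s v"
  by (simp add: vec_eq_iff scaleR_conv_of_real[of r "z :: complex" for z])

lemma norm_vector_smult: "norm (k *s v) = norm k * norm (v :: complex ^ 'n::finite)"
  by (simp add: norm_vec_def norm_mult L2_set_right_distrib)

lemma inner_vector_smult:
  "(k *s v) \<bullet> (k *s w) = (norm k)\<^sup>2 * (v \<bullet> w)" for v w :: "complex ^ 'n::finite"
  unfolding inner_vec_def inner_complex_def sum_distrib_left cmod_power2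
  by (intro sum.cong refl) (simp add: power2_eq_square algebra_simps)

lemma bounded_linear_vector_smult_left: "bounded_linear (\<lambda>k. k *s (v :: complex ^ 'n::finite))"
  by (rule bounded_linear_intro[where K = "norm v"])
     (simp_all add: vec_eq_iff algebra_simps norm_vector_smult)

lemma bounded_linear_vector_smult_right: "bounded_linear (\<lambda>v :: complex ^ 'n::finite. k *s v)"
  by (rule bounded_linear_intro[where K = "norm k"])
     (simp_all add: vec_eq_iff algebra_simps norm_vector_smult)

lemma complex_differentiable_at_line:
  assumes "complex_differentiable_at f (z + \<zeta> *s v)"
  shows "((\<lambda>\<zeta>. f (z + \<zeta> *s v)) has_field_derivative
           frechet_derivative f (at (z + \<zeta> *s v)) v) (at \<zeta>)"
proof -
  have "((\<lambda>\<zeta>. z + \<zeta> *s v) has_derivative (\<lambda>k. k *s v)) (at \<zeta>)"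
    by (auto intro!: derivative_eq_intros bounded_linear.has_derivative[OF bounded_linear_vector_smult_left])
  from has_derivative_compose[OF this complex_differentiable_atD(1)[OF assms]]
  show ?thesis
    by (simp add: has_field_derivative_def complex_differentiable_atD(2)[OF assms] mult_commute_abs)
qed

text \<open>Cauchy's formula for the derivative at 0 of the slice
  \<open>\<zeta> \<mapsto> f (z + \<zeta> v)\<close>. Over the fixed interval \<open>[0,1]\<close>
  it is a parameter integral in \<open>z\<close>, ready for differentiation under the integral
  sign.\<close>

lemma frechet_derivative_circle_integral:
  assumes "\<rho> > 0" and S: "\<And>\<zeta>. norm \<zeta> \<le> \<rho> \<Longrightarrow> complex_differentiable_at f (z + \<zeta> *s v)"
  shows "frechet_derivative f (at z) v =
    integral (cbox 0 1) (\<lambda>t::real. (1 / (of_real \<rho> * exp (2 * of_real pi * \<i> * of_real t))) *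
       f (z + (of_real \<rho> * exp (2 * of_real pi * \<i> * of_real t)) *s v))"
proof -
  define h where "h = (\<lambda>\<zeta>. f (z + \<zeta> *s v))"
  have d: "(h has_field_derivative frechet_derivative f (at (z + \<zeta> *s v)) v) (at \<zeta>)"
    if "norm \<zeta> \<le> \<rho>" for \<zeta>
    unfolding h_def by (rule complex_differentiable_at_line[OF S[OF that]])
  have c: "continuous_on (cball 0 \<rho>) h"
    by (intro continuous_at_imp_continuous_on ballI DERIV_isCont[OF d]) auto
  have ho: "h holomorphic_on ball 0 \<rho>"
    by (rule holomorphic_onI) (meson d field_differentiable_def field_differentiable_at_within mem_ball_0 less_imp_le)
  have "(h has_field_derivative (1 / (2 * of_real pi * \<i>) *
      contour_integral (circlepath 0 \<rho>) (\<lambda>u. h u / (u - 0)^2))) (at 0)"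
    by (rule Cauchy_derivative_integral_circlepath(2)[OF c ho]) (use assms in auto)
  with d[of 0] have "frechet_derivative f (at z) v = 1 / (2 * of_real pi * \<i>) *
      contour_integral (circlepath 0 \<rho>) (\<lambda>u. h u / (u - 0)^2)"
    using assms DERIV_unique by fastforce
  also have "\<dots> = integral {0..1} (\<lambda>t. 1 / (2 * of_real pi * \<i>) *
      (h (circlepath 0 \<rho> t) / (circlepath 0 \<rho> t - 0)^2 * vector_derivative (circlepath 0 \<rho>) (at t)))"
    unfolding contour_integral_integral by (rule integral_mult_right[symmetric])
  \<comment> \<open>With \<open>e(t)\<close> the point on the circle, its velocity
    \<open>2 pi \<i> e(t)\<close> cancels \<open>1/(2 pi \<i>)\<close> and one of the two powers of
    \<open>e(t)\<close> in the denominator.\<close>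
  also have "\<dots> = integral (cbox 0 1) (\<lambda>t::real. (1 / (of_real \<rho> * exp (2 * of_real pi * \<i> * of_real t))) *
       h (of_real \<rho> * exp (2 * of_real pi * \<i> * of_real t)))"
    unfolding box_real
    unfolding vector_derivative_circlepath unfolding circlepath
    by (rule integral_cong) (use assms in \<open>simp add: power2_eq_square\<close>)
  finally show ?thesis by (simp add: h_def)
qed

text \<open>The Cauchy integral is used as a function of its base point, so one radius has to serve
  all base points near \<open>z\<close>.\<close>

lemma polydisc_neighbourhood:
  assumes "open S" "z \<in> S"
  obtains \<delta> \<rho> where "\<delta> > 0" "\<rho> > 0"
    "\<And>y (\<zeta> :: complex). y \<in> ball z \<delta> \<Longrightarrow> norm \<zeta> \<le> \<rho> \<Longrightarrow> y + \<zeta> *s (v :: complex ^ 'n::finite) \<in> S"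
proof -
  from assms obtain e where e: "e > 0" "ball z e \<subseteq> S" by (meson open_contains_ball)
  show thesis
  \<comment> \<open>The summand 1 keeps the radius positive when \<open>v = 0\<close>.\<close>
  proof (rule that[of "e/2" "e / (2 * (norm v + 1))"])
    show "e/2 > 0" "e / (2 * (norm v + 1)) > 0" using e by (auto simp: add_nonneg_pos)
    fix y and \<zeta> :: complex assume y: "y \<in> ball z (e/2)" and \<zeta>: "norm \<zeta> \<le> e / (2 * (norm v + 1))"
    have "norm \<zeta> * norm v \<le> e / (2 * (norm v + 1)) * norm v" by (intro mult_right_mono \<zeta>) auto
    also have "\<dots> \<le> e/2" using e by (simp add: divide_simps add_nonneg_pos)
    finally have "norm (\<zeta> *s v) \<le> e/2" by (simp add: norm_vector_smult)
    with y have "dist z (y + \<zeta> *s v) < e"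
      using dist_triangle[of z "y + \<zeta> *s v" y] by (auto simp: dist_norm)
    with e show "y + \<zeta> *s v \<in> S" by auto
  qed
qed

locale complex_differentiable_on_open =
  fixes S :: "(complex ^ 'n::finite) set" and f :: "complex ^ 'n \<Rightarrow> complex"
  assumes open_S: "open S" and diff: "\<And>z. z \<in> S \<Longrightarrow> complex_differentiable_at f z"
begin

lemma continuous_on_f: "continuous_on S f"
  by (intro continuous_at_imp_continuous_on ballI differentiable_imp_continuous_within)
     (use diff in \<open>auto simp: complex_differentiable_at_def\<close>)

text \<open>Continuity of the differential is a consequence of Cauchy's formula: the integrand is
  jointly continuous in the base point and \<open>t\<close>.\<close>

lemma continuous_on_directional_derivative:
  "continuous_on S (\<lambda>z. frechet_derivative f (at z) v)"
proof (rule continuous_at_imp_continuous_on, rule ballI)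
  fix z assume "z \<in> S"
  then obtain \<delta> \<rho> where \<delta>: "\<delta> > 0" "\<rho> > 0"
    and in_S: "\<And>y \<zeta>. y \<in> ball z \<delta> \<Longrightarrow> norm \<zeta> \<le> \<rho> \<Longrightarrow> y + \<zeta> *s v \<in> S"
    using polydisc_neighbourhood[OF open_S, of z v] by metis
  define e where "e = (\<lambda>t::real. of_real \<rho> * exp (2 * of_real pi * \<i> * of_real t))"
  have e: "norm (e t) = \<rho>" "e t \<noteq> 0" for t using \<delta> by (auto simp: e_def norm_mult)
  have "continuous_on (ball z \<delta>) (\<lambda>y. integral (cbox 0 1) (\<lambda>t. (1 / e t) * f (y + e t *s v)))"
  proof (rule integral_continuous_on_param, unfold split_beta, intro continuous_intros)
    show "continuous_on (ball z \<delta> \<times> cbox 0 1) (\<lambda>p. f (fst p + e (snd p) *s v))"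
      by (rule continuous_on_compose2[OF continuous_on_f])
         (auto intro!: in_S continuous_intros bounded_linear.continuous_on[OF bounded_linear_vector_smult_left]
            simp: e e_def[symmetric] simp del: mem_ball, auto simp: e_def intro!: continuous_intros)
  qed (use e in \<open>auto simp: e_def intro!: continuous_intros\<close>)
  moreover have "frechet_derivative f (at y) v = integral (cbox 0 1) (\<lambda>t. (1 / e t) * f (y + e t *s v))"
    if "y \<in> ball z \<delta>" for y
    unfolding e_def
    by (rule frechet_derivative_circle_integral) (use that \<delta> in \<open>auto intro!: diff in_S\<close>)
  ultimately have "continuous_on (ball z \<delta>) (\<lambda>y. frechet_derivative f (at y) v)"
    using continuous_on_eq by fastforce
  then show "isCont (\<lambda>y. frechet_derivative f (at y) v) z"
    using \<delta> by (simp add: continuous_on_eq_continuous_at)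
qed

text \<open>Differentiation of the Cauchy integral under the integral sign. \<open>L\<close> is
  exposed as an explicit integral because complex linearity and the symmetry of second derivatives
  are both read off from it.\<close>

lemma directional_derivative_has_derivative:
  assumes "z \<in> S"
  obtains \<rho> L where "\<rho> > 0" "((\<lambda>y. frechet_derivative f (at y) v) has_derivative L) (at z)"
    "\<And>\<zeta>. norm \<zeta> \<le> \<rho> \<Longrightarrow> z + \<zeta> *s v \<in> S"
    "\<And>w. L w = integral (cbox 0 1) (\<lambda>t::real. (1 / (of_real \<rho> * exp (2 * of_real pi * \<i> * of_real t))) *
       frechet_derivative f (at (z + (of_real \<rho> * exp (2 * of_real pi * \<i> * of_real t)) *s v)) w)"
proof -
  from assms obtain \<delta> \<rho> where \<delta>: "\<delta> > 0" "\<rho> > 0"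
    and in_S: "\<And>y \<zeta>. y \<in> ball z \<delta> \<Longrightarrow> norm \<zeta> \<le> \<rho> \<Longrightarrow> y + \<zeta> *s v \<in> S"
    using polydisc_neighbourhood[OF open_S, of z v] by metis
  define e where "e = (\<lambda>t::real. of_real \<rho> * exp (2 * of_real pi * \<i> * of_real t))"
  have e: "norm (e t) = \<rho>" "e t \<noteq> 0" for t using \<delta> by (auto simp: e_def norm_mult)
  have cont_e: "continuous_on A (\<lambda>p. e (g p))" if "continuous_on A g" for A and g :: "'z::topological_space \<Rightarrow> real"
    unfolding e_def by (intro continuous_intros that)
  have cont_line: "continuous_on (ball z \<delta> \<times> cbox 0 1) (\<lambda>p. fst p + e (snd p) *s v)"
    by (intro continuous_intros bounded_linear.continuous_on[OF bounded_linear_vector_smult_left] cont_e)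
  \<comment> \<open>The Leibniz rule asks for an operator-valued integrand that is continuous in
    norm; in finite dimension this reduces to continuity of its values on basis vectors.\<close>
  define F where "F = (\<lambda>y t. Blinfun (\<lambda>w. (1 / e t) * frechet_derivative f (at (y + e t *s v)) w))"
  have F: "blinfun_apply (F y t) = (\<lambda>w. (1 / e t) * frechet_derivative f (at (y + e t *s v)) w)"
    if "y \<in> ball z \<delta>" for y t
    unfolding F_def
    by (rule bounded_linear_Blinfun_apply)
       (use that \<delta> e in \<open>intro bounded_linear_const_mult has_derivative_bounded_linear[OF complex_differentiable_atD(1)] diff in_S; simp\<close>)
  have contF: "continuous_on (ball z \<delta> \<times> cbox 0 1) (\<lambda>(y, t). F y t)"
  proof (rule continuous_on_blinfun_componentwise, unfold split_beta)
    fix i :: "complex ^ 'n"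
    have "continuous_on (ball z \<delta> \<times> cbox 0 1)
        (\<lambda>p. (1 / e (snd p)) * frechet_derivative f (at (fst p + e (snd p) *s v)) i)"
      by (intro continuous_intros continuous_on_compose2[OF continuous_on_directional_derivative cont_line] cont_e)
         (auto simp: e simp del: mem_ball intro!: in_S)
    then show "continuous_on (ball z \<delta> \<times> cbox 0 1) (\<lambda>p. blinfun_apply (F (fst p) (snd p)) i)"
      by (rule continuous_on_cong[THEN iffD1, rotated 2]) (auto simp: F)
  qed
  have zb: "z \<in> ball z \<delta>" using \<delta> by simp
  have "((\<lambda>y. integral (cbox 0 1) (\<lambda>t. (1 / e t) * f (y + e t *s v))) has_derivative
      blinfun_apply (integral (cbox 0 1) (F z))) (at z within ball z \<delta>)"
  proof (rule leibniz_rule[OF _ _ contF zb convex_ball])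
    fix y and t :: real assume y: "y \<in> ball z \<delta>"
    have "(f has_derivative frechet_derivative f (at (y + e t *s v))) (at (y + e t *s v))"
      by (intro complex_differentiable_atD(1) diff in_S y) (simp add: e)
    moreover have "((\<lambda>y. y + e t *s v) has_derivative (\<lambda>h. h)) (at y within ball z \<delta>)"
      by (auto intro!: derivative_eq_intros)
    ultimately have "((\<lambda>y. f (y + e t *s v)) has_derivative frechet_derivative f (at (y + e t *s v)))
       (at y within ball z \<delta>)"
      using has_derivative_compose by blast
    then show "((\<lambda>y. (1 / e t) * f (y + e t *s v)) has_derivative F y t) (at y within ball z \<delta>)"
      unfolding F[OF y] by (rule has_derivative_mult_right)
  next
    fix y assume y: "y \<in> ball z \<delta>"
    show "(\<lambda>t. (1 / e t) * f (y + e t *s v)) integrable_on cbox 0 1"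
      by (intro integrable_continuous continuous_intros continuous_on_compose2[OF continuous_on_f] cont_e
            bounded_linear.continuous_on[OF bounded_linear_vector_smult_left])
         (auto simp: e simp del: mem_ball intro!: in_S y)
  qed
  moreover have eq: "frechet_derivative f (at y) v = integral (cbox 0 1) (\<lambda>t. (1 / e t) * f (y + e t *s v))"
    if "y \<in> ball z \<delta>" for y
    unfolding e_def
    by (rule frechet_derivative_circle_integral) (use that \<delta> in \<open>auto intro!: diff in_S\<close>)
  ultimately have "((\<lambda>y. frechet_derivative f (at y) v) has_derivative
      blinfun_apply (integral (cbox 0 1) (F z))) (at z within ball z \<delta>)"
    by (rule has_derivative_transform[OF zb, rotated]) (simp add: eq)
  then have "((\<lambda>y. frechet_derivative f (at y) v) has_derivative
      blinfun_apply (integral (cbox 0 1) (F z))) (at z)"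
    using at_within_open[OF zb] by simp
  moreover have "F z integrable_on cbox 0 1"
    by (rule integrable_continuous)
       (use continuous_on_compose2[OF contF, of "cbox 0 1" "\<lambda>t. (z, t)"] \<delta> in \<open>force simp: continuous_on_Pair image_subset_iff\<close>)
  ultimately show thesis
    by (intro that[OF \<delta>(2), where L = "blinfun_apply (integral (cbox 0 1) (F z))"])
       (auto simp: blinfun_apply_integral F[OF zb] in_S[OF zb] e_def)
qed

text \<open>The integral for \<open>L\<close> inherits complex linearity from the differentials of
  \<open>f\<close> on the circle. Complex differentiation can therefore be iterated.\<close>

theorem complex_differentiable_at_directional_derivative:
  assumes "z \<in> S"
  shows "complex_differentiable_at (\<lambda>y. frechet_derivative f (at y) v) z"
proof -
  obtain \<rho> L where L: "\<rho> > 0" "((\<lambda>y. frechet_derivative f (at y) v) has_derivative L) (at z)"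
    "\<And>\<zeta>. norm \<zeta> \<le> \<rho> \<Longrightarrow> z + \<zeta> *s v \<in> S"
    "\<And>w. L w = integral (cbox 0 1) (\<lambda>t::real. (1 / (of_real \<rho> * exp (2 * of_real pi * \<i> * of_real t))) *
       frechet_derivative f (at (z + (of_real \<rho> * exp (2 * of_real pi * \<i> * of_real t)) *s v)) w)"
    by (rule directional_derivative_has_derivative[OF assms, of v]) blast
  show ?thesis
  proof (rule complex_differentiable_atI[OF L(2)])
    fix k w
    have "frechet_derivative f (at (z + (of_real \<rho> * exp (2 * of_real pi * \<i> * of_real t)) *s v)) (k *s w) =
      k * frechet_derivative f (at (z + (of_real \<rho> * exp (2 * of_real pi * \<i> * of_real t)) *s v)) w" for t :: real
      by (rule complex_differentiable_atD(2)[OF diff[OF L(3)]]) (use L(1) in \<open>simp add: norm_mult\<close>)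
    then show "L (k *s w) = k * L w"
      unfolding L(4) integral_mult_right[symmetric] by (simp add: mult.left_commute)
  qed
qed

text \<open>The integral representing \<open>L w\<close> is itself Cauchy's formula for the
  \<open>v\<close>-derivative of the \<open>w\<close>-derivative of \<open>f\<close>, so the two
  mixed derivatives are one and the same integral.\<close>

theorem directional_derivatives_commute:
  assumes "z \<in> S"
  shows "frechet_derivative (\<lambda>y. frechet_derivative f (at y) v) (at z) w =
         frechet_derivative (\<lambda>y. frechet_derivative f (at y) w) (at z) v"
proof -
  obtain \<rho> L where L: "\<rho> > 0" "((\<lambda>y. frechet_derivative f (at y) v) has_derivative L) (at z)"
    "\<And>\<zeta>. norm \<zeta> \<le> \<rho> \<Longrightarrow> z + \<zeta> *s v \<in> S"
    "\<And>w. L w = integral (cbox 0 1) (\<lambda>t::real. (1 / (of_real \<rho> * exp (2 * of_real pi * \<i> * of_real t))) *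
       frechet_derivative f (at (z + (of_real \<rho> * exp (2 * of_real pi * \<i> * of_real t)) *s v)) w)"
    by (rule directional_derivative_has_derivative[OF assms, of v]) blast
  have "L w = frechet_derivative (\<lambda>y. frechet_derivative f (at y) w) (at z) v"
    unfolding L(4) using L(1,3)
    by (intro frechet_derivative_circle_integral[symmetric] complex_differentiable_at_directional_derivative)
  with frechet_derivative_at[OF L(2)] show ?thesis by simp
qed

end

lemma complex_differentiable_at_cong_open:
  assumes "complex_differentiable_at f z" "open S" "z \<in> S" "\<And>y. y \<in> S \<Longrightarrow> f y = g y"
  shows "complex_differentiable_at g z"
proof -
  have "(g has_derivative frechet_derivative f (at z)) (at z)"
    using has_derivative_transform_within_open[OF complex_differentiable_atD(1)] assms by blast
  then show ?thesis
    using complex_differentiable_atD(2)[OF assms(1)] by (rule complex_differentiable_atI)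
qed

section \<open>Componentwise derivatives, Cramer's rule and inverse functions\<close>

lemma vec_eq_sum_axis: "x = (\<Sum>i\<in>UNIV. x $ i *s axis i 1)" for x :: "complex ^ 'n::finite"
  by (simp add: vec_eq_iff axis_def if_distrib cong: if_cong)

lemma has_derivative_vecI:
  fixes f :: "'v::real_normed_vector \<Rightarrow> complex ^ 'n::finite"
  assumes "\<And>i. ((\<lambda>y. f y $ i) has_derivative (\<lambda>h. f' h $ i)) (at z)"
  shows "(f has_derivative f') (at z)"
proof -
  have "((\<lambda>y. \<Sum>i\<in>UNIV. f y $ i *s axis i 1) has_derivative (\<lambda>h. \<Sum>i\<in>UNIV. f' h $ i *s axis i 1)) (at z)"
    by (intro has_derivative_sum bounded_linear.has_derivative[OF bounded_linear_vector_smult_left] assms)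
  then show ?thesis by (simp flip: vec_eq_sum_axis)
qed

lemma differentiable_vecI:
  fixes f :: "'v::real_normed_vector \<Rightarrow> complex ^ 'n::finite"
  assumes "\<And>i. (\<lambda>y. f y $ i) differentiable (at z)"
  shows "f differentiable (at z)"
proof -
  from assms obtain D where "((\<lambda>y. f y $ i) has_derivative D i) (at z)" for i
    unfolding differentiable_def by metis
  then have "(f has_derivative (\<lambda>h. \<chi> i. D i h)) (at z)" by (intro has_derivative_vecI) simp
  then show ?thesis by (auto simp: differentiable_def)
qed

lemma differentiable_prod:
  fixes f :: "'i \<Rightarrow> 'v::real_normed_vector \<Rightarrow> 'b::real_normed_field"
  assumes "\<And>i. i \<in> I \<Longrightarrow> f i differentiable (at z)"
  shows "(\<lambda>y. \<Prod>i\<in>I. f i y) differentiable (at z)"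
proof -
  from assms obtain D where "\<And>i. i \<in> I \<Longrightarrow> (f i has_derivative D i) (at z)"
    unfolding differentiable_def by metis
  from has_derivative_prod[where f = f and I = I, OF this] show ?thesis by (auto simp: differentiable_def)
qed

lemma differentiable_det:
  fixes M :: "'v::real_normed_vector \<Rightarrow> complex ^ 'n ^ 'n::finite"
  assumes "\<And>i j. (\<lambda>y. M y $ i $ j) differentiable (at z)"
  shows "(\<lambda>y. det (M y)) differentiable (at z)"
  unfolding det_def
proof (intro differentiable_sum differentiable_mult ballI)
  show "(\<lambda>y. \<Prod>i\<in>UNIV. M y $ i $ p i) differentiable (at z)" for p
    by (intro differentiable_prod assms)
qed auto

text \<open>By Cramer's rule the solution near \<open>z\<close> is a quotient of determinants, which
  are polynomials in the entries. The application is the linear system that determines the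
  Christoffel symbols.\<close>

lemma differentiable_linear_system_solution:
  fixes M :: "'v::real_normed_vector \<Rightarrow> complex ^ 'n ^ 'n::finite"
  assumes M: "\<And>i j. (\<lambda>y. M y $ i $ j) differentiable (at z)"
    and d: "\<And>i. (\<lambda>y. d y $ i) differentiable (at z)"
    and S: "open S" "z \<in> S" "\<And>y. y \<in> S \<Longrightarrow> invertible (M y)" "\<And>y. y \<in> S \<Longrightarrow> M y *v c y = d y"
  shows "c differentiable (at z)"
proof -
  define c' where "c' = (\<lambda>y. \<chi> k. det (\<chi> i j. if j = k then d y $ i else M y $ i $ j) / det (M y))"
  have "c' differentiable (at z)"
    unfolding c'_def
  proof (rule differentiable_vecI)
    fix k
    have "(\<lambda>y. if j = k then d y $ i else M y $ i $ j) differentiable (at z)" for i j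
      using M d by (cases "j = k") auto
    then show "(\<lambda>y. (\<chi> k. det (\<chi> i j. if j = k then d y $ i else M y $ i $ j) / det (M y)) $ k) differentiable (at z)"
      using S(3)[OF S(2)] by (auto intro!: differentiable_divide differentiable_det M simp: invertible_det_nz)
  qed
  moreover have "c' y = c y" if "y \<in> S" for y
    using cramer[of "M y" "c y" "d y"] S(3,4)[OF that] by (simp add: c'_def invertible_det_nz)
  ultimately show ?thesis
    using S(1,2) has_derivative_transform_within_open unfolding differentiable_def by metis
qed

text \<open>Independence of the component differentials makes the complex Jacobian invertible, and
  Cauchy's formula makes it continuous, so the real inverse function theorem applies. The derivative
  \<open>G\<close> of the inverse is recorded only through \<open>df o G = id\<close>, the form in
  which the chain rule for \<open>b\<close> uses it.\<close>

lemma holomorphic_inverse_function: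
  fixes f :: "complex ^ 'n::finite \<Rightarrow> complex ^ 'n"
  assumes S: "open S" "x \<in> S"
    and diff: "\<And>z i. z \<in> S \<Longrightarrow> complex_differentiable_at (\<lambda>y. f y $ i) z"
    and indep: "\<And>l. (\<forall>v. (\<Sum>i\<in>UNIV. l $ i * frechet_derivative (\<lambda>y. f y $ i) (at x) v) = 0) \<Longrightarrow> l = 0"
  obtains U V g G where "open U" "U \<subseteq> S" "x \<in> U" "open V" "homeomorphism U V f g"
    "(g has_derivative G) (at (f x))"
    "\<And>h i. frechet_derivative (\<lambda>y. f y $ i) (at x) (G h) = h $ i"
proof -
  have f_i: "complex_differentiable_on_open S (\<lambda>y. f y $ i)" for i
    by unfold_locales (use S diff in auto)
  define F where "F = (\<lambda>z. Blinfun (\<lambda>v. \<chi> i. frechet_derivative (\<lambda>y. f y $ i) (at z) v))"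
  have df: "(f has_derivative (\<lambda>v. \<chi> i. frechet_derivative (\<lambda>y. f y $ i) (at z) v)) (at z)" if "z \<in> S" for z
    by (rule has_derivative_vecI) (use complex_differentiable_atD(1)[OF diff[OF that]] in simp)
  have F: "blinfun_apply (F z) = (\<lambda>v. \<chi> i. frechet_derivative (\<lambda>y. f y $ i) (at z) v)" if "z \<in> S" for z
    unfolding F_def by (rule bounded_linear_Blinfun_apply[OF has_derivative_bounded_linear[OF df[OF that]]])
  have contF: "continuous_on S F"
  proof (rule continuous_on_blinfun_componentwise)
    fix v :: "complex ^ 'n"
    have "continuous_on S (\<lambda>z. \<chi> i. frechet_derivative (\<lambda>y. f y $ i) (at z) v)"
      by (intro continuous_on_vec_lambda complex_differentiable_on_open.continuous_on_directional_derivative f_i)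
    then show "continuous_on S (\<lambda>z. blinfun_apply (F z) v)"
      by (rule continuous_on_eq) (simp add: F)
  qed
  define M where "M = (\<chi> i j. frechet_derivative (\<lambda>y. f y $ i) (at x) (axis j 1))"
  have M: "frechet_derivative (\<lambda>y. f y $ i) (at x) v = (M *v v) $ i" for i v
  proof -
    note lin = complex_differentiable_atD(2,3)[OF diff[OF S(2), of i]]
    have "frechet_derivative (\<lambda>y. f y $ i) (at x) v =
        frechet_derivative (\<lambda>y. f y $ i) (at x) (\<Sum>j\<in>UNIV. v $ j *s axis j 1)"
      by (simp flip: vec_eq_sum_axis)
    also have "\<dots> = (M *v v) $ i"
      by (simp add: linear_sum[OF lin(2)] lin(1) M_def matrix_vector_mult_def mult.commute)
    finally show ?thesis .
  qed
  \<comment> \<open>A linear relation between the rows of \<open>M\<close> is a kernel vector of its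
    transpose.\<close>
  have "l = 0" if "transpose M *v l = 0" for l
  proof (rule indep, rule allI)
    fix v
    have "(\<Sum>i\<in>UNIV. l $ i * frechet_derivative (\<lambda>y. f y $ i) (at x) v) =
       (\<Sum>i\<in>UNIV. \<Sum>j\<in>UNIV. l $ i * (M $ i $ j * v $ j))"
      unfolding M by (simp add: matrix_vector_mult_def sum_distrib_left)
    also have "\<dots> = (\<Sum>j\<in>UNIV. (transpose M *v l) $ j * v $ j)"
      by (subst sum.swap) (simp add: matrix_vector_mult_def transpose_def sum_distrib_left sum_distrib_right mult_ac)
    finally show "(\<Sum>i\<in>UNIV. l $ i * frechet_derivative (\<lambda>y. f y $ i) (at x) v) = 0"
      unfolding that by simp
  qed
  then have "invertible (transpose M)"
    unfolding invertible_left_inverse matrix_left_invertible_ker by blast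
  then obtain N' where "N' ** transpose M = mat 1"
    unfolding invertible_left_inverse by blast
  then have "M ** transpose N' = mat 1"
    by (metis matrix_transpose_mul transpose_transpose transpose_mat)
  then obtain N where N: "N ** M = mat 1"
    using matrix_left_right_inverse by blast
  have blN: "bounded_linear ((*v) N)"
    by (rule matrix_vector_mul_bounded_linear)
  have inv: "Blinfun ((*v) N) o\<^sub>L F x = id_blinfun"
    by (rule blinfun_eqI)
       (simp add: bounded_linear_Blinfun_apply[OF blN] F[OF S(2)] M matrix_vector_mul_assoc N)
  obtain U V g g' where g: "open U" "U \<subseteq> S" "x \<in> U" "open V" "f x \<in> V" "homeomorphism U V f g"
    "\<And>y. y \<in> V \<Longrightarrow> (g has_derivative (g' y)) (at y)"
    "\<And>y. y \<in> V \<Longrightarrow> g' y = inv (blinfun_apply (F (g y)))"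
    "\<And>y. y \<in> V \<Longrightarrow> bij (blinfun_apply (F (g y)))"
    by (rule inverse_function_theorem[of S f F, OF S(1) _ contF S(2) inv]) (use df in \<open>auto simp: F\<close>)
  have gx: "g (f x) = x" using g(6,3) by (rule homeomorphism_apply1)
  have "blinfun_apply (F x) (g' (f x) h) = h" for h
    using g(8,9)[OF g(5)] unfolding gx by (simp add: bij_is_surj surj_f_inv_f)
  then have "frechet_derivative (\<lambda>y. f y $ i) (at x) (g' (f x) h) = h $ i" for h i
    unfolding F[OF S(2)] by (metis vec_lambda_beta)
  then show thesis
    using g by (intro that[of U V g "g' (f x)"]) auto
qed

section \<open>Christoffel symbols and curvature in special coordinates\<close>

definition im_matrix :: "complex ^ 'n ^ 'm \<Rightarrow> complex ^ 'n ^ 'm" where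
  "im_matrix M = (\<chi> i j. of_real (Im (M $ i $ j)))"

definition cnj_vec :: "complex ^ 'n \<Rightarrow> complex ^ 'n" where
  "cnj_vec v = (\<chi> i. cnj (v $ i))"

text \<open>Complex bilinear rather than Hermitian: complex symmetric matrices are self-adjoint for
  it, and conjugations stay visible through \<open>cnj_vec\<close>.\<close>

definition bilinear_dot :: "complex ^ 'n::finite \<Rightarrow> complex ^ 'n \<Rightarrow> complex" where
  "bilinear_dot v w = (\<Sum>i\<in>UNIV. v $ i * w $ i)"

lemma inner_complex_vec: "v \<bullet> w = Re (bilinear_dot v (cnj_vec w))" for v w :: "complex ^ 'n::finite"
  by (simp add: inner_vec_def bilinear_dot_def cnj_vec_def inner_complex_def)

lemma bilinear_dot_matrix_symmetric:
  assumes "\<And>i j. M $ i $ j = M $ j $ i"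
  shows "bilinear_dot (M *v v) w = bilinear_dot (M *v w) v"
proof -
  have "bilinear_dot (M *v v) w = (\<Sum>i\<in>UNIV. \<Sum>j\<in>UNIV. M $ i $ j * v $ j * w $ i)"
    by (simp add: bilinear_dot_def matrix_vector_mult_def sum_distrib_right)
  also have "\<dots> = (\<Sum>j\<in>UNIV. \<Sum>i\<in>UNIV. M $ j $ i * w $ i * v $ j)"
    by (subst sum.swap) (use assms in \<open>simp add: mult_ac\<close>)
  also have "\<dots> = bilinear_dot (M *v w) v"
    by (simp add: bilinear_dot_def matrix_vector_mult_def sum_distrib_right)
  finally show ?thesis .
qed

text \<open>Entrywise this is \<open>Im (m x) + Im (m (cnj x)) = 2 Im m Re x\<close>. It trades the
  imaginary part for \<open>M\<close> itself, so that complex symmetries of derivatives of the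
  period matrix become applicable.\<close>

lemma im_matrix_inner:
  fixes M :: "complex ^ 'n ^ 'n::finite"
  shows "(im_matrix M *v v) \<bullet> w =
    (Im (bilinear_dot (M *v v) (cnj_vec w)) + Im (bilinear_dot (M *v cnj_vec v) w)) / 2"
proof -
  have "(Im (bilinear_dot (M *v v) (cnj_vec w)) + Im (bilinear_dot (M *v cnj_vec v) w)) / 2 =
    (\<Sum>i\<in>UNIV. \<Sum>j\<in>UNIV. (Im (M $ i $ j * v $ j * cnj (w $ i)) + Im (M $ i $ j * cnj (v $ j) * w $ i)) / 2)"
    by (simp add: bilinear_dot_def matrix_vector_mult_def sum_distrib_right cnj_vec_def Im_sum
        del: times_complex.sel flip: sum_divide_distrib sum.distrib)
  also have "\<dots> = (\<Sum>i\<in>UNIV. \<Sum>j\<in>UNIV. Re (of_real (Im (M $ i $ j)) * v $ j * cnj (w $ i)))"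
    by (intro sum.cong refl) (simp add: algebra_simps)
  also have "\<dots> = (im_matrix M *v v) \<bullet> w"
    by (simp add: inner_complex_vec bilinear_dot_def matrix_vector_mult_def sum_distrib_right
        cnj_vec_def Re_sum im_matrix_def del: times_complex.sel)
  finally show ?thesis by simp
qed

text \<open>Exchanging \<open>i\<close> and \<open>j\<close> fixes \<open>Im (M $ i $ j)\<close> and
  negates \<open>Im (v $ j * cnj (v $ i))\<close>, so the sum equals its own negative. This is what
  makes \<open>\<i> v\<close> orthogonal to \<open>v\<close>.\<close>

lemma im_matrix_hermitian:
  fixes M :: "complex ^ 'n ^ 'n::finite"
  assumes "\<And>i j. M $ i $ j = M $ j $ i"
  shows "Im (bilinear_dot (im_matrix M *v v) (cnj_vec v)) = 0"
proof -
  define X where "X = (\<Sum>i\<in>UNIV. \<Sum>j\<in>UNIV. Im (M $ i $ j) * Im (v $ j * cnj (v $ i)))"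
  have "X = (\<Sum>i\<in>UNIV. \<Sum>j\<in>UNIV. Im (M $ j $ i) * Im (v $ i * cnj (v $ j)))"
    unfolding X_def by (rule sum.swap)
  also have "\<dots> = - X"
    unfolding X_def sum_negf[symmetric]
    by (intro sum.cong refl) (subst assms, simp add: algebra_simps)
  finally have "X = 0" by simp
  moreover have "Im (bilinear_dot (im_matrix M *v v) (cnj_vec v)) = X"
    by (simp add: X_def bilinear_dot_def matrix_vector_mult_def im_matrix_def cnj_vec_def
        sum_distrib_right Im_sum mult.assoc del: times_complex.sel)
       (simp add: algebra_simps)
  ultimately show ?thesis by simp
qed

text \<open>\<open>sk_metric\<close> contracts \<open>v\<close> with the row index, the matrix
  product contracts it with the column index; symmetry reconciles the two.\<close>

lemma sk_metric_eq_inner: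
  assumes "\<And>i j. \<tau> x $ i $ j = \<tau> x $ j $ i"
  shows "sk_metric \<tau> x v w = (im_matrix (\<tau> x) *v v) \<bullet> w"
proof -
  have "sk_metric \<tau> x v w = (\<Sum>i\<in>UNIV. \<Sum>j\<in>UNIV. Re (of_real (Im (\<tau> x $ i $ j)) * v $ i * cnj (w $ j)))"
    by (simp add: sk_metric_def Re_sum del: times_complex.sel)
  also have "\<dots> = (\<Sum>j\<in>UNIV. \<Sum>i\<in>UNIV. Re (of_real (Im (\<tau> x $ j $ i)) * v $ i * cnj (w $ j)))"
    by (subst sum.swap, intro sum.cong refl) (metis assms)
  also have "\<dots> = (im_matrix (\<tau> x) *v v) \<bullet> w"
    by (simp add: inner_complex_vec bilinear_dot_def matrix_vector_mult_def sum_distrib_right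
        cnj_vec_def Re_sum im_matrix_def del: times_complex.sel)
  finally show ?thesis .
qed

lemma im_matrix_vec_Re_Im:
  fixes M :: "complex ^ 'n ^ 'n::finite"
  shows "(im_matrix M *v v) \<bullet> v =
    (\<Sum>i\<in>UNIV. \<Sum>j\<in>UNIV. Im (M $ i $ j) * Re (v $ i) * Re (v $ j)) +
    (\<Sum>i\<in>UNIV. \<Sum>j\<in>UNIV. Im (M $ i $ j) * Im (v $ i) * Im (v $ j))"
  by (simp add: inner_complex_vec bilinear_dot_def matrix_vector_mult_def sum_distrib_right
        cnj_vec_def Re_sum im_matrix_def flip: sum.distrib)
     (simp add: algebra_simps)

text \<open>The real and imaginary parts of \<open>v\<close> contribute separately to the form,
  without cross terms, and at least one of them is nonzero.\<close>

lemma im_matrix_pos_def: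
  fixes M :: "complex ^ 'n ^ 'n::finite"
  assumes "\<And>v :: real ^ 'n. v \<noteq> 0 \<Longrightarrow> (\<Sum>i\<in>UNIV. \<Sum>j\<in>UNIV. Im (M $ i $ j) * v $ i * v $ j) > 0"
    and "v \<noteq> 0"
  shows "(im_matrix M *v v) \<bullet> v > 0"
proof -
  define q where "q = (\<lambda>v :: real ^ 'n. \<Sum>i\<in>UNIV. \<Sum>j\<in>UNIV. Im (M $ i $ j) * v $ i * v $ j)"
  have q: "(im_matrix M *v v) \<bullet> v = q (\<chi> i. Re (v $ i)) + q (\<chi> i. Im (v $ i))"
    by (simp add: im_matrix_vec_Re_Im q_def)
  have pos: "q u > 0" if "u \<noteq> 0" for u
    using assms(1)[OF that] by (simp add: q_def)
  have "q 0 = 0" by (simp add: q_def)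
  with pos have nonneg: "q u \<ge> 0" for u by (cases "u = 0") (auto intro: less_imp_le)
  have "(\<chi> i. Re (v $ i)) \<noteq> 0 \<or> (\<chi> i. Im (v $ i)) \<noteq> 0"
    using assms(2) by (auto simp: vec_eq_iff complex_eq_iff)
  then show ?thesis
    using pos nonneg unfolding q by (blast intro: add_pos_nonneg add_nonneg_pos)
qed

text \<open>The local model: the periods \<open>a\<close> are the coordinates on \<open>W\<close>,
  and \<open>B\<close> and \<open>T\<close> are the dual periods and the period matrix as functions
  of them. Symmetry and positivity are available at every \<open>z\<close>, since outside
  \<open>W\<close> the matrix \<open>T z\<close> is still a value of \<tau> at some point of the
  manifold.\<close>

locale special_coordinates =
  fixes W :: "(complex ^ 'r::finite) set"
    and B :: "'r \<Rightarrow> complex ^ 'r \<Rightarrow> complex"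
    and T :: "complex ^ 'r \<Rightarrow> complex ^ 'r ^ 'r"
  assumes open_W: "open W"
    and B_diff: "\<And>z i. z \<in> W \<Longrightarrow> complex_differentiable_at (B i) z"
    and B_deriv: "\<And>z i v. z \<in> W \<Longrightarrow> frechet_derivative (B i) (at z) v = (T z *v v) $ i"
    and T_sym: "\<And>z i j. T z $ i $ j = T z $ j $ i"
    and T_pos: "\<And>z (v :: real ^ 'r). v \<noteq> 0 \<Longrightarrow>
         (\<Sum>i\<in>UNIV. \<Sum>j\<in>UNIV. Im (T z $ i $ j) * v $ i * v $ j) > 0"
begin

definition dT :: "complex ^ 'r \<Rightarrow> complex ^ 'r \<Rightarrow> complex ^ 'r ^ 'r" where
  "dT z v = (\<chi> i j. frechet_derivative (\<lambda>y. T y $ i $ j) (at z) v)"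

abbreviation A where "A z \<equiv> im_matrix (T z)"

abbreviation \<Gamma> where "\<Gamma> \<equiv> christoffel (sk_metric T)"

lemma metric_eq: "sk_metric T z v w = (A z *v v) \<bullet> w"
  by (rule sk_metric_eq_inner) (rule T_sym)

lemma metric_pos: "v \<noteq> 0 \<Longrightarrow> sk_metric T z v v > 0"
  unfolding metric_eq by (rule im_matrix_pos_def[OF T_pos])

lemma A_inj: "A z *v v = A z *v w \<Longrightarrow> v = w"
  using metric_pos[of "v - w" z]
  by (auto simp: metric_eq matrix_vector_mult_diff_distrib)

lemma invertible_A: "invertible (A z)"
  unfolding invertible_left_inverse matrix_left_invertible_injective
  by (auto intro: injI A_inj)

section \<open>Third derivatives of the prepotential and the Levi-Civita connection\<close>

sublocale B: complex_differentiable_on_open W "B i" for i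
  by unfold_locales (auto intro: open_W B_diff)

text \<open>Each entry of \<open>T\<close> is the derivative of some \<open>B i\<close> along a
  coordinate axis, so the period matrix is holomorphic because \<open>b\<close> is.\<close>

lemma T_diff: "z \<in> W \<Longrightarrow> complex_differentiable_at (\<lambda>y. T y $ i $ j) z"
  by (rule complex_differentiable_at_cong_open[OF
        B.complex_differentiable_at_directional_derivative[of z i "axis j 1"] open_W])
     (auto simp: B_deriv matrix_vector_mult_def axis_def if_distrib cong: if_cong)

sublocale T: complex_differentiable_on_open W "\<lambda>y. T y $ i $ j" for i j
  by unfold_locales (auto intro: open_W T_diff)

lemma T_has_derivative:
  "z \<in> W \<Longrightarrow> ((\<lambda>y. T y $ i $ j) has_derivative (\<lambda>h. dT z h $ i $ j)) (at z)"
  using complex_differentiable_atD(1)[OF T_diff] by (simp add: dT_def)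

lemma dT_diff: "z \<in> W \<Longrightarrow> complex_differentiable_at (\<lambda>y. dT y v $ i $ j) z"
  by (simp add: dT_def T.complex_differentiable_at_directional_derivative)

lemma dT_sym: "dT z v $ i $ j = dT z v $ j $ i"
  by (simp add: dT_def T_sym[of _ i j])

lemma dT_smult: "z \<in> W \<Longrightarrow> dT z (k *s v) $ i $ j = k * dT z v $ i $ j"
  by (simp add: dT_def complex_differentiable_atD(2)[OF T_diff])

lemma dT_smult_mult: "z \<in> W \<Longrightarrow> dT z (k *s v) *v w = k *s (dT z v *v w)"
  by (simp add: vec_eq_iff matrix_vector_mult_def dT_smult sum_distrib_left mult_ac)

text \<open>Each component is a mixed second derivative of \<open>B i\<close>. Together with
  \<open>dT_sym\<close> this gives total symmetry of \<open>dT\<close>, the tensor of third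
  derivatives of the prepotential.\<close>

lemma dT_commute:
  assumes "z \<in> W"
  shows "dT z v *v w = dT z w *v v"
proof -
  have "(dT z v *v w) $ i = frechet_derivative (\<lambda>y. frechet_derivative (B i) (at y) w) (at z) v" for v w i
  proof -
    have "((\<lambda>y. (T y *v w) $ i) has_derivative (\<lambda>h. (dT z h *v w) $ i)) (at z)"
      unfolding matrix_vector_mult_def
      by (auto intro!: derivative_eq_intros T_has_derivative assms)
    then have "((\<lambda>y. frechet_derivative (B i) (at y) w) has_derivative (\<lambda>h. (dT z h *v w) $ i)) (at z)"
      by (rule has_derivative_transform_within_open[OF _ open_W assms]) (simp add: B_deriv)
    then show ?thesis by (simp add: frechet_derivative_at[symmetric])
  qed
  then show ?thesis
    using B.directional_derivatives_commute[OF assms] by (simp add: vec_eq_iff)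
qed

lemma metric_has_derivative:
  assumes "z \<in> W"
  shows "((\<lambda>y. sk_metric T y v w) has_derivative (\<lambda>h. (im_matrix (dT z h) *v v) \<bullet> w)) (at z)"
  unfolding metric_eq inner_vec_def matrix_vector_mult_def im_matrix_def
  by (auto intro!: derivative_eq_intros bounded_linear.has_derivative[OF bounded_linear_Im]
       bounded_linear.has_derivative[OF bounded_linear_of_real] T_has_derivative assms simp: im_matrix_def)

text \<open>After expansion by \<open>im_matrix_inner\<close>, total symmetry of \<open>dT\<close>
  cancels in pairs the terms with \<open>v\<close> or \<open>w\<close> conjugated; the term with
  \<open>u\<close> conjugated survives twice, absorbing the factor 1/2.\<close>

lemma koszul:
  assumes "z \<in> W"
  shows "((-\<i>) *s (dT z v *v w)) \<bullet> u =
     (im_matrix (dT z v) *v w) \<bullet> u + (im_matrix (dT z w) *v v) \<bullet> u - (im_matrix (dT z u) *v v) \<bullet> w"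
proof -
  have 1: "((-\<i>) *s (dT z v *v w)) \<bullet> u = Im (bilinear_dot (dT z v *v w) (cnj_vec u))"
    by (simp add: inner_complex_vec bilinear_dot_def Re_sum Im_sum del: times_complex.sel mult_minus_left) (simp add: algebra_simps)
  have s: "bilinear_dot (dT z p *v q) r = bilinear_dot (dT z p *v r) q" for p q r
    by (rule bilinear_dot_matrix_symmetric) (rule dT_sym)
  have c: "bilinear_dot (dT z p *v q) r = bilinear_dot (dT z q *v p) r" for p q r
    by (simp add: dT_commute[OF assms, of p q])
  have "bilinear_dot (dT z v *v cnj_vec w) u = bilinear_dot (dT z u *v v) (cnj_vec w)"
    using s c by metis
  moreover have "bilinear_dot (dT z w *v cnj_vec v) u = bilinear_dot (dT z u *v cnj_vec v) w"
    using s c by metis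
  moreover note c[of w v "cnj_vec u"]
  ultimately show ?thesis unfolding 1 im_matrix_inner by (simp add: field_simps)
qed

text \<open>By \<open>koszul\<close> the right side of the defining formula is the inner product of
  \<open>u\<close> with a fixed vector, so testing against all \<open>u\<close> is a single linear
  equation.\<close>

theorem A_christoffel:
  assumes "z \<in> W"
  shows "A z *v \<Gamma> z v w = (-\<i>/2) *s (dT z v *v w)"
proof -
  have fr: "frechet_derivative (\<lambda>y. sk_metric T y p q) (at z) h = (im_matrix (dT z h) *v p) \<bullet> q" for p q h
    using frechet_derivative_at[OF metric_has_derivative[OF assms, of p q]] by metis
  have iff: "(\<forall>u. 2 * sk_metric T z c u =
       frechet_derivative (\<lambda>y. sk_metric T y w u) (at z) v
     + frechet_derivative (\<lambda>y. sk_metric T y v u) (at z) w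
     - frechet_derivative (\<lambda>y. sk_metric T y v w) (at z) u) \<longleftrightarrow> A z *v c = (-\<i>/2) *s (dT z v *v w)" for c
  proof -
    have "2 * sk_metric T z c u = (2 *\<^sub>R (A z *v c)) \<bullet> u" for u
      by (simp add: metric_eq)
    then have "(\<forall>u. 2 * sk_metric T z c u =
       frechet_derivative (\<lambda>y. sk_metric T y w u) (at z) v
     + frechet_derivative (\<lambda>y. sk_metric T y v u) (at z) w
     - frechet_derivative (\<lambda>y. sk_metric T y v w) (at z) u) \<longleftrightarrow> 2 *\<^sub>R (A z *v c) = (-\<i>) *s (dT z v *v w)"
      unfolding fr koszul[OF assms, symmetric] by (metis vector_eq_rdot)
    also have "\<dots> \<longleftrightarrow> A z *v c = (-\<i>/2) *s (dT z v *v w)"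
      by (simp add: vec_eq_iff scaleR_conv_of_real field_simps)
    finally show ?thesis .
  qed
  \<comment> \<open>\<open>christoffel\<close> is a definite description, so both existence and
    uniqueness must be supplied; they come from invertibility of \<open>A z\<close>.\<close>
  have "\<exists>!c. A z *v c = (-\<i>/2) *s (dT z v *v w)"
    using A_inj invertible_A[of z] unfolding invertible_def
    by (metis matrix_vector_mul_assoc matrix_vector_mul_lid)
  then show ?thesis
    unfolding christoffel_def iff by (rule theI')
qed

text \<open>The right side of \<open>A_christoffel\<close> is complex linear in \<open>v\<close>,
  and likewise in \<open>w\<close>. For the connection this is the Kaehler property: multiplication
  by \<open>\<i>\<close> is parallel.\<close>

lemma christoffel_smult_left: "z \<in> W \<Longrightarrow> \<Gamma> z (k *s v) w = k *s \<Gamma> z v w"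
  by (rule A_inj[of z]) (simp add: A_christoffel vec.scale dT_smult_mult mult.commute)

lemma christoffel_smult_right: "z \<in> W \<Longrightarrow> \<Gamma> z v (k *s w) = k *s \<Gamma> z v w"
  by (rule A_inj[of z]) (simp add: A_christoffel vec.scale mult.commute)

text \<open>\<open>curvature\<close> contains \<open>frechet_derivative\<close> of the symbols, a
  meaningful value only once they are known to be differentiable.\<close>

lemma christoffel_differentiable:
  assumes "z \<in> W"
  shows "(\<lambda>y. \<Gamma> y v w) differentiable (at z)"
proof (rule differentiable_linear_system_solution[OF _ _ open_W assms invertible_A A_christoffel])
  show "(\<lambda>y. A y $ i $ j) differentiable (at z)" for i j
    using bounded_linear.has_derivative[OF bounded_linear_compose[OF bounded_linear_of_real bounded_linear_Im]
        T_has_derivative[OF assms, of i j]]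
    by (auto simp: im_matrix_def differentiable_def)
  show "(\<lambda>y. ((-\<i>/2) *s (dT y v *v w)) $ i) differentiable (at z)" for i
    using dT_diff[OF assms, of v i]
    by (auto simp: matrix_vector_mult_def complex_differentiable_at_def
        intro!: differentiable_sum differentiable_mult)
qed

text \<open>Differentiate \<open>A \<Gamma>(v,v) = -(\<i>/2) dT(v) v\<close>. The right side is
  holomorphic, so second derivatives of \<open>T\<close> drop out of the difference between
  direction \<open>k v\<close> and \<open>k\<close> times direction \<open>v\<close>; only
  derivatives of the non-holomorphic \<open>A\<close> remain.\<close>

lemma A_curvature:
  assumes z: "z \<in> W"
  shows "A z *v curvature (sk_metric T) z (k *s v) v v =
     k *s (im_matrix (dT z v) *v \<Gamma> z v v) - im_matrix (dT z (k *s v)) *v \<Gamma> z v v"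
proof -
  define c where "c = (\<lambda>y. \<Gamma> y v v)"
  define c' where "c' = frechet_derivative c (at z)"
  have c: "(c has_derivative c') (at z)"
    using christoffel_differentiable[OF z, of v v] by (simp add: c_def c'_def frechet_derivative_works)
  then have "((\<lambda>y. k *s c y) has_derivative (\<lambda>h. k *s c' h)) (at z)"
    by (rule bounded_linear.has_derivative[OF bounded_linear_vector_smult_right])
  then have "((\<lambda>y. \<Gamma> y (k *s v) v) has_derivative (\<lambda>h. k *s c' h)) (at z)"
    by (rule has_derivative_transform_within_open[OF _ open_W z]) (simp add: c_def christoffel_smult_left)
  from frechet_derivative_at[OF this, symmetric]
  \<comment> \<open>The two terms quadratic in the symbols cancel by complex bilinearity.\<close>
  have "curvature (sk_metric T) z (k *s v) v v = c' (k *s v) - k *s c' v"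
    unfolding curvature_def
    by (simp add: c'_def c_def christoffel_smult_left christoffel_smult_right z)
  then have 1: "A z *v curvature (sk_metric T) z (k *s v) v v = A z *v c' (k *s v) - k *s (A z *v c' v)"
    by (simp add: matrix_vector_mult_diff_distrib vec.scale)
  define L where "L = (\<lambda>h. im_matrix (dT z h) *v c z + A z *v c' h)"
  have "((\<lambda>y. A y *v c y) has_derivative L) (at z)"
    unfolding L_def
    by (rule has_derivative_vecI)
       (auto simp: im_matrix_def matrix_vector_mult_def sum.distrib algebra_simps
       intro!: derivative_eq_intros bounded_linear.has_derivative[OF bounded_linear_Im]
       bounded_linear.has_derivative[OF bounded_linear_of_real]
       bounded_linear.has_derivative[OF bounded_linear_vec_nth] T_has_derivative z c)
  then have L: "((\<lambda>y. (-\<i>/2) *s (dT y v *v v)) has_derivative L) (at z)"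
    by (rule has_derivative_transform_within_open[OF _ open_W z]) (simp add: c_def A_christoffel)
  define L' where "L' = (\<lambda>h. (-\<i>/2) *s (\<chi> i. \<Sum>j\<in>UNIV. frechet_derivative (\<lambda>y. dT y v $ i $ j) (at z) h * v $ j))"
  have "((\<lambda>y. (-\<i>/2) *s (dT y v *v v)) has_derivative L') (at z)"
    unfolding L'_def matrix_vector_mult_def
    by (rule has_derivative_vecI)
       (auto simp: intro!: derivative_eq_intros complex_differentiable_atD(1) dT_diff z)
  \<comment> \<open>The product rule and the holomorphic expression differentiate the same function;
    \<open>L'\<close> shows that the result is complex linear.\<close>
  with L have "L = L'" by (rule has_derivative_unique)
  moreover have "L' (k *s v) = k *s L' v"
    unfolding L'_def by (simp add: vec_eq_iff complex_differentiable_atD(2)[OF dT_diff] z sum_distrib_left mult_ac)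
  ultimately have "L (k *s v) = k *s L v" by simp
  then show ?thesis
    unfolding 1 L_def c_def by (simp add: algebra_simps vector_add_ldistrib)
qed

text \<open>The real factor \<open>s\<close> is carried along so that the formula applies directly
  to the test field, where it is a cosine.\<close>

theorem holomorphic_sectional_curvature:
  assumes z: "z \<in> W"
  shows "sk_metric T z (curvature (sk_metric T) z ((\<i> * of_real s) *s v) v v) ((\<i> * of_real s) *s v) =
     2 * s\<^sup>2 * sk_metric T z (\<Gamma> z v v) (\<Gamma> z v v)"
proof -
  define c where "c = \<Gamma> z v v"
  have e: "(dT z v *v v) $ i = 2 * \<i> * (A z *v c) $ i" for i
    by (simp add: c_def A_christoffel[OF z])
  \<comment> \<open>For \<open>k = \<i> s\<close> the matrices combine as
    \<open>\<i> s Im M - s Re M = -s cnj M\<close> with \<open>M = dT z v\<close>.\<close>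
  have "A z *v curvature (sk_metric T) z ((\<i> * of_real s) *s v) v v =
      (- of_real s) *s (\<chi> i. \<Sum>j\<in>UNIV. cnj (dT z v $ i $ j) * c $ j)"
    unfolding A_curvature[OF z] c_def
    by (simp add: vec_eq_iff matrix_vector_mult_def im_matrix_def dT_smult z sum_distrib_left
        flip: sum_subtractf sum_negf)
       (auto intro!: sum.cong simp: complex_eq_iff algebra_simps)
  then have "sk_metric T z (curvature (sk_metric T) z ((\<i> * of_real s) *s v) v v) ((\<i> * of_real s) *s v) =
    Re (\<Sum>i\<in>UNIV. \<Sum>j\<in>UNIV. (\<i> * of_real (s\<^sup>2)) * (cnj (dT z v $ i $ j) * c $ j * cnj (v $ i)))"
    unfolding metric_eq
    by (simp add: inner_complex_vec bilinear_dot_def cnj_vec_def sum_distrib_left sum_distrib_right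
       mult_ac power2_eq_square del: times_complex.sel flip: sum_negf)
  also have "(\<Sum>i\<in>UNIV. \<Sum>j\<in>UNIV. (\<i> * of_real (s\<^sup>2)) * (cnj (dT z v $ i $ j) * c $ j * cnj (v $ i))) =
     (\<Sum>j\<in>UNIV. (\<i> * of_real (s\<^sup>2)) * (cnj ((dT z v *v v) $ j) * c $ j))"
    by (subst sum.swap, subst dT_sym) (simp add: matrix_vector_mult_def sum_distrib_left sum_distrib_right mult_ac)
  \<comment> \<open>Conjugating \<open>e\<close> gives the factor \<open>-2 \<i>\<close>, which
    against \<open>\<i> s^2\<close> yields the positive constant \<open>2 s^2\<close>.\<close>
  also have "\<dots> = (\<Sum>j\<in>UNIV. of_real (2 * s\<^sup>2) * (cnj ((A z *v c) $ j) * c $ j))"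
    unfolding e by (intro sum.cong refl) (simp add: complex_eq_iff algebra_simps)
  also have "Re \<dots> = 2 * s\<^sup>2 * sk_metric T z c c"
    unfolding metric_eq
    by (simp add: inner_vec_def inner_complex_def sum_distrib_left algebra_simps)
  finally show ?thesis unfolding c_def .
qed

end

section \<open>Special coordinates on the manifold\<close>

text \<open>Resolves the choice hidden in \<open>special_inv\<close>: whichever domain is chosen,
  results on special domains apply to its inverse.\<close>

lemma special_inv_in_special_domain:
  assumes "\<exists>U. x \<in> U \<and> special_domain a U"
  obtains U where "x \<in> U" "special_domain a U" "special_inv a x = inv_into U a"
  using someI_ex[OF assms] that unfolding special_inv_def by blast

context special_kaehler_manifold
begin

section \<open>The periods as local coordinates\<close>

context
  fixes c :: "('a, 'r) chart"
  assumes c: "c \<in> atlas"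
begin

lemma chart_facts:
  "open (fst c)" "open (snd c ` fst c)"
  "homeomorphism (fst c) (snd c ` fst c) (snd c) (chart_inv c)"
  "x \<in> fst c \<Longrightarrow> chart_inv c (snd c x) = x"
  using chart_homeomorphism[OF c] by (auto simp: homeomorphism_apply1)

lemma periods_differentiable_in_chart:
  assumes "z \<in> snd c ` fst c"
  shows "complex_differentiable_at (\<lambda>y. (a \<circ> chart_inv c) y $ i) z"
    and "complex_differentiable_at (\<lambda>y. (b \<circ> chart_inv c) y $ i) z"
  using assms a_holomorphic[of i] b_holomorphic[of i] c
  unfolding holomorphic_function_def holomorphic_in_chart_at_def chart_differential_def
    complex_differentiable_at_def o_def by blast+

lemma special_coordinates_near:
  assumes x: "x \<in> fst c"
  obtains U V g G where "open U" "U \<subseteq> snd c ` fst c" "snd c x \<in> U" "open V"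
    "homeomorphism U V (a \<circ> chart_inv c) g" "(g has_derivative G) (at (a x))"
    "\<And>h i. chart_differential c (\<lambda>y. a y $ i) x (G h) = h $ i"
proof -
  have fx: "(a \<circ> chart_inv c) (snd c x) = a x" by (simp add: chart_facts(4)[OF x])
  have d: "frechet_derivative (\<lambda>y. (a \<circ> chart_inv c) y $ i) (at (snd c x)) =
      chart_differential c (\<lambda>y. a y $ i) x" for i
    by (simp add: chart_differential_def o_def)
  show thesis
  proof (rule holomorphic_inverse_function[OF chart_facts(2) imageI[OF x] periods_differentiable_in_chart(1)],
      unfold d fx)
    show "l = 0" if "\<forall>v. (\<Sum>i\<in>UNIV. l $ i * chart_differential c (\<lambda>y. a y $ i) x v) = 0" for l
      using da_independent[OF c x that] .
  qed (assumption, rule that)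
qed

end

lemma chart_at: obtains c where "c \<in> atlas" "x \<in> fst c"
  using charts_cover by blast

text \<open>The neighbourhood from the inverse function theorem lies in chart coordinates; it is
  pulled back to the manifold through the chart.\<close>

lemma special_domain_exists: "\<exists>U. x \<in> U \<and> special_domain a U"
proof -
  obtain c where c: "c \<in> atlas" "x \<in> fst c" by (rule chart_at)
  note cf = chart_facts[OF c(1)]
  obtain U V g G where U: "open U" "U \<subseteq> snd c ` fst c" "snd c x \<in> U" "open V"
    "homeomorphism U V (a \<circ> chart_inv c) g"
    by (rule special_coordinates_near[OF c]) blast
  define X where "X = chart_inv c ` U"
  have X: "X = fst c \<inter> snd c -` U"
    using U(2) cf(4) by (force simp: X_def)
  have "continuous_on (fst c) (snd c)" using cf(3) by (simp add: homeomorphism_def)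
  then have "open X" unfolding X using cf(1) U(1) by (intro continuous_open_preimage)
  have hX: "homeomorphism X U (snd c) (chart_inv c)"
    by (rule homeomorphism_of_subsets[OF cf(3)]) (use U(2) cf(4) in \<open>auto simp: X\<close>)
  have "homeomorphism X V ((a \<circ> chart_inv c) \<circ> snd c) (chart_inv c \<circ> g)"
    by (rule homeomorphism_compose[OF hX U(5)])
  then have h: "homeomorphism X V a (chart_inv c \<circ> g)"
    by (rule homeomorphism_cong) (use cf(4) in \<open>auto simp: X\<close>)
  then have V: "V = a ` X" and inj: "inj_on a X"
    by (auto simp: homeomorphism_def intro: inj_on_inverseI)
  \<comment> \<open>\<open>special_domain\<close> prescribes \<open>inv_into\<close> as the inverse;
    on \<open>V\<close> it agrees with the inverse just constructed.\<close>
  have "homeomorphism X V a (inv_into X a)"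
    by (rule homeomorphism_cong[OF h]) (use V inj homeomorphism_apply1[OF h] in auto)
  then have "special_domain a X"
    using \<open>open X\<close> U(4) V by (simp add: special_domain_def)
  moreover have "x \<in> X" using c(2) U(3) by (simp add: X)
  ultimately show ?thesis by blast
qed

text \<open>Chain rule through an atlas chart: \<open>db = \<tau> da\<close> there, and
  \<open>da\<close> composed with the derivative of the inverse coordinate map is the
  identity.\<close>

lemma special_coordinates_on_domain:
  assumes U: "special_domain a U"
  shows "special_coordinates (a ` U) (\<lambda>i z. b (inv_into U a z) $ i) (\<lambda>z. \<tau> (inv_into U a z))"
proof -
  have openU: "open U" and open_aU: "open (a ` U)" and hom: "homeomorphism U (a ` U) a (inv_into U a)"
    using U by (auto simp: special_domain_def)
  have db: "((\<lambda>z. b (inv_into U a z) $ i) has_derivative (\<lambda>h. (\<tau> (inv_into U a z) *v h) $ i)) (at z)"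
    if z: "z \<in> a ` U" for z i
  proof -
    define x where "x = inv_into U a z"
    have x: "x \<in> U" "a x = z" using z by (auto simp: x_def inv_into_into f_inv_into_f)
    obtain c where c: "c \<in> atlas" "x \<in> fst c" by (rule chart_at)
    note cf = chart_facts[OF c(1)]
    obtain X V g G where X: "open X" "X \<subseteq> snd c ` fst c" "snd c x \<in> X" "open V"
      "homeomorphism X V (a \<circ> chart_inv c) g" "(g has_derivative G) (at (a x))"
      "\<And>h i. chart_differential c (\<lambda>y. a y $ i) x (G h) = h $ i"
      by (rule special_coordinates_near[OF c]) blast
    \<comment> \<open>On \<open>Y\<close> the given inverse of \<open>a\<close> and the local
      inverse \<open>g\<close> describe the same points, so near \<open>z\<close> the dual period is
      \<open>f o g\<close>. The domain \<open>U\<close> itself may exceed a single chart.\<close>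
    define Y where "Y = U \<inter> (fst c \<inter> snd c -` X)"
    have "continuous_on (fst c) (snd c)" using cf(3) by (simp add: homeomorphism_def)
    then have "open Y" unfolding Y_def using cf(1) X(1) openU by (intro open_Int continuous_open_preimage)
    then have "openin (top_of_set (a ` U)) (a ` Y)"
      by (intro homeomorphism_imp_open_map[OF hom]) (auto simp: Y_def openin_open)
    then have "open (a ` Y)" using open_aU by (rule openin_open_trans)
    have zY: "z \<in> a ` Y" using x c(2) X(3) by (auto simp: Y_def)
    have g_eq: "g (a y) = snd c y" if "y \<in> Y" for y
      using homeomorphism_apply1[OF X(5), of "snd c y"] that cf(4) by (auto simp: Y_def)
    have inv: "inv_into U a (a y) = y" if "y \<in> Y" for y
      using homeomorphism_apply1[OF hom, of y] that by (auto simp: Y_def)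
    define f where "f = (\<lambda>y. (b \<circ> chart_inv c) y $ i)"
    have "(f has_derivative chart_differential c (\<lambda>y. b y $ i) x) (at (g (a x)))"
      using complex_differentiable_atD(1)[OF periods_differentiable_in_chart(2)[OF c(1), of "snd c x" i]] c(2) g_eq[of x] x X(3)
      by (simp add: f_def chart_differential_def o_def Y_def)
    from has_derivative_compose[OF X(6) this]
    have "((\<lambda>y. f (g y)) has_derivative (\<lambda>h. chart_differential c (\<lambda>y. b y $ i) x (G h))) (at z)"
      by (simp add: x)
    then have "((\<lambda>y. f (g y)) has_derivative (\<lambda>h. (\<tau> x *v h) $ i)) (at z)"
      by (simp add: db_eq[OF c] X(7) matrix_vector_mult_def)
    then show ?thesis
      unfolding x_def[symmetric]
      by (rule has_derivative_transform_within_open[OF _ \<open>open (a ` Y)\<close> zY])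
         (auto simp: f_def g_eq inv, auto simp: Y_def cf(4))
  qed
  show ?thesis
  proof
    show "open (a ` U)" by (rule open_aU)
    fix z i assume z: "z \<in> a ` U"
    show "complex_differentiable_at (\<lambda>z. b (inv_into U a z) $ i) z"
      by (rule complex_differentiable_atI[OF db[OF z]])
         (simp add: vec.scale)
    show "frechet_derivative (\<lambda>z. b (inv_into U a z) $ i) (at z) v = (\<tau> (inv_into U a z) *v v) $ i" for v
      using frechet_derivative_at[OF db[OF z, of i]] by metis
  qed (use \<tau>_symmetric Im_\<tau>_pos_def in auto)
qed

lemma sk_metric_coord_eq:
  "sk_metric_coord a \<tau> x = sk_metric (\<lambda>z. \<tau> (special_inv a x z))"
  by (auto simp: sk_metric_coord_def sk_metric_def fun_eq_iff)

lemma special_coordinates_at: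
  obtains W where "a x \<in> W" "special_inv a x (a x) = x"
    "special_coordinates W (\<lambda>i z. b (special_inv a x z) $ i) (\<lambda>z. \<tau> (special_inv a x z))"
proof -
  obtain U where U: "x \<in> U" "special_domain a U" "special_inv a x = inv_into U a"
    using special_inv_in_special_domain[OF special_domain_exists] by blast
  then have "homeomorphism U (a ` U) a (inv_into U a)" by (simp add: special_domain_def)
  with U special_coordinates_on_domain[OF U(2)] show thesis
    by (intro that[of "a ` U"]) (auto simp: homeomorphism_apply1)
qed

lemma sk_christoffel_smult_right:
  "sk_christoffel a \<tau> x v (k *s w) = k *s sk_christoffel a \<tau> x v w"
  using special_coordinates_at[of x] special_coordinates.christoffel_smult_right
  unfolding sk_christoffel_def sk_metric_coord_eq by metis

lemma sk_holomorphic_sectional_curvature: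
  "sk_metric \<tau> x (sk_curvature a \<tau> x ((\<i> * of_real s) *s v) v v) ((\<i> * of_real s) *s v) =
     2 * s\<^sup>2 * sk_metric \<tau> x (sk_christoffel a \<tau> x v v) (sk_christoffel a \<tau> x v v)"
proof -
  obtain W where W: "a x \<in> W" "special_inv a x (a x) = x"
    "special_coordinates W (\<lambda>i z. b (special_inv a x z) $ i) (\<lambda>z. \<tau> (special_inv a x z))"
    by (rule special_coordinates_at)
  have m: "sk_metric (\<lambda>z. \<tau> (special_inv a x z)) (a x) = sk_metric \<tau> x"
    by (simp add: sk_metric_def fun_eq_iff W(2))
  show ?thesis
    using special_coordinates.holomorphic_sectional_curvature[OF W(3,1)]
    unfolding m sk_christoffel_def sk_curvature_def sk_metric_coord_eq .
qed

lemma sk_metric_inner: "sk_metric \<tau> x v w = (im_matrix (\<tau> x) *v v) \<bullet> w"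
  by (rule sk_metric_eq_inner) (rule \<tau>_symmetric)

lemma sk_metric_pos: "v \<noteq> 0 \<Longrightarrow> sk_metric \<tau> x v v > 0"
  unfolding sk_metric_inner by (rule im_matrix_pos_def[OF Im_\<tau>_pos_def])

text \<open>In special coordinates the period matrix is holomorphic. Its continuity is used to make
  the curvature term along a geodesic continuous.\<close>

lemma continuous_on_\<tau>: "continuous_on UNIV (\<lambda>x. \<tau> x $ i $ j)"
proof (rule continuous_at_imp_continuous_on, rule ballI)
  fix x
  obtain U where U: "x \<in> U" "special_domain a U" using special_domain_exists by blast
  then have openU: "open U" and hom: "homeomorphism U (a ` U) a (inv_into U a)"
    by (auto simp: special_domain_def)
  interpret special_coordinates "a ` U" "\<lambda>i z. b (inv_into U a z) $ i" "\<lambda>z. \<tau> (inv_into U a z)"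
    by (rule special_coordinates_on_domain[OF U(2)])
  have "continuous_on U (\<lambda>y. \<tau> (inv_into U a (a y)) $ i $ j)"
    by (rule continuous_on_compose2[OF T.continuous_on_f]) (use hom in \<open>auto simp: homeomorphism_def\<close>)
  then have "continuous_on U (\<lambda>y. \<tau> y $ i $ j)"
    by (rule continuous_on_eq) (simp add: homeomorphism_apply1[OF hom])
  then show "isCont (\<lambda>y. \<tau> y $ i $ j) x"
    using openU U(1) by (simp add: continuous_on_eq_continuous_at)
qed

text \<open>As \<open>a\<close> is only locally injective, agreement must propagate along the line:
  the agreement set is closed by the Hausdorff property, open by local injectivity, and
  nonempty.\<close>

lemma curve_determined_by_periods:
  assumes \<gamma>: "continuous_on UNIV \<gamma>" and \<delta>: "continuous_on UNIV \<delta>"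
    and eq: "\<And>t :: real. a (\<gamma> t) = a (\<delta> t)" and t0: "\<gamma> t0 = \<delta> t0"
  shows "\<gamma> = \<delta>"
proof -
  define E where "E = {t. \<gamma> t = \<delta> t}"
  have "closed E" unfolding E_def by (rule closed_Collect_eq[OF \<gamma> \<delta>])
  moreover have "open E"
  proof (rule Topological_Spaces.openI)
    fix t assume t: "t \<in> E"
    obtain U where U: "\<gamma> t \<in> U" "special_domain a U" using special_domain_exists by blast
    then have "open U" and hom: "homeomorphism U (a ` U) a (inv_into U a)"
      by (auto simp: special_domain_def)
    have inj: "inj_on a U"
      by (rule inj_on_inverseI) (rule homeomorphism_apply1[OF hom])
    have "open (\<gamma> -` U \<inter> \<delta> -` U)"
      using \<gamma> \<delta> \<open>open U\<close> by (intro open_Int open_vimage)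
    moreover have "t \<in> \<gamma> -` U \<inter> \<delta> -` U" using t U by (simp add: E_def)
    moreover have "\<gamma> -` U \<inter> \<delta> -` U \<subseteq> E"
    proof
      fix s assume "s \<in> \<gamma> -` U \<inter> \<delta> -` U"
      then show "s \<in> E"
        using inj_onD[OF inj eq[of s]] by (simp add: E_def)
    qed
    ultimately show "\<exists>T. open T \<and> t \<in> T \<and> T \<subseteq> E" by blast
  qed
  ultimately have "E = {} \<or> E = UNIV" using clopen by blast
  with t0 show ?thesis by (auto simp: E_def fun_eq_iff)
qed

end

section \<open>The second variation of a stable geodesic\<close>

lemma smooth_curve_curve_derivative: "smooth_curve f \<Longrightarrow> smooth_curve (curve_derivative f)"
  unfolding smooth_curve_def by (metis funpow_simps_right(2) o_apply)

lemma smooth_curve_has_vector_derivative: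
  assumes "smooth_curve f"
  shows "(f has_vector_derivative curve_derivative f t) (at t)"
proof -
  have "(curve_derivative ^^ 0) f differentiable (at t)"
    using assms unfolding smooth_curve_def by blast
  then show ?thesis by (simp add: curve_derivative_def flip: vector_derivative_works)
qed

lemma curve_derivativeI: "(\<And>t. (f has_vector_derivative f' t) (at t)) \<Longrightarrow> curve_derivative f = f'"
  by (rule ext) (simp add: curve_derivative_def vector_derivative_at)

lemma smooth_curve_bounded_linear:
  assumes "bounded_linear L" "smooth_curve f"
  shows "smooth_curve (\<lambda>t. L (f t))"
proof -
  have "(curve_derivative ^^ n) (\<lambda>t. L (f t)) = (\<lambda>t. L ((curve_derivative ^^ n) f t))" for n
  proof (induction n)
    case (Suc n)
    have "curve_derivative (\<lambda>t. L ((curve_derivative ^^ n) f t)) = (\<lambda>t. L (curve_derivative ((curve_derivative ^^ n) f) t))"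
      using assms(2)
      by (intro curve_derivativeI bounded_linear.has_vector_derivative[OF assms(1)])
         (simp add: smooth_curve_def curve_derivative_def flip: vector_derivative_works)
    with Suc show ?case by simp
  qed simp
  then show ?thesis
    using assms(2) bounded_linear.has_derivative[OF assms(1)]
    unfolding smooth_curve_def differentiable_def by metis
qed

lemma smooth_curve_add:
  assumes "smooth_curve f" "smooth_curve g"
  shows "smooth_curve (\<lambda>t. f t + g t)"
proof -
  have "(curve_derivative ^^ n) (\<lambda>t. f t + g t) =
      (\<lambda>t. (curve_derivative ^^ n) f t + (curve_derivative ^^ n) g t)" for n
  proof (induction n)
    case (Suc n)
    have "curve_derivative (\<lambda>t. (curve_derivative ^^ n) f t + (curve_derivative ^^ n) g t) =
       (\<lambda>t. curve_derivative ((curve_derivative ^^ n) f) t + curve_derivative ((curve_derivative ^^ n) g) t)"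
      using assms
      by (intro curve_derivativeI has_vector_derivative_add)
         (simp_all add: smooth_curve_def curve_derivative_def flip: vector_derivative_works)
    with Suc show ?case by simp
  qed simp
  then show ?thesis using assms by (simp add: smooth_curve_def)
qed

text \<open>The family of combinations is closed under differentiation, which makes the induction work.\<close>

lemma smooth_curve_trigonometric_combination:
  fixes p q :: "real \<Rightarrow> 'v::real_normed_vector"
  assumes "smooth_curve p" "smooth_curve q"
  shows "smooth_curve (\<lambda>t. cos (c * t) *\<^sub>R p t + sin (c * t) *\<^sub>R q t)"
proof -
  have d: "((\<lambda>t. cos (c * t) *\<^sub>R p t + sin (c * t) *\<^sub>R q t) has_vector_derivative
      cos (c * t) *\<^sub>R (curve_derivative p t + c *\<^sub>R q t) +
      sin (c * t) *\<^sub>R (curve_derivative q t + (-c) *\<^sub>R p t)) (at t)"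
    if "smooth_curve p" "smooth_curve q" for p q :: "real \<Rightarrow> 'v" and t
    using that[THEN smooth_curve_has_vector_derivative, of t]
    by (auto intro!: derivative_eq_intros simp: has_real_derivative_iff_has_vector_derivative[symmetric] algebra_simps)
  have "\<forall>t. (curve_derivative ^^ n) (\<lambda>t. cos (c * t) *\<^sub>R p t + sin (c * t) *\<^sub>R q t) differentiable (at t)" for n
    using assms
  proof (induction n arbitrary: p q)
    case 0
    show ?case using differentiableI_vector[OF d[OF 0]] by simp
  next
    case (Suc n)
    have "smooth_curve (\<lambda>t. curve_derivative p t + c *\<^sub>R q t)" "smooth_curve (\<lambda>t. curve_derivative q t + (-c) *\<^sub>R p t)"
      by (intro smooth_curve_add smooth_curve_curve_derivative Suc.prems
          smooth_curve_bounded_linear[OF bounded_linear_scaleR_right])+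
    from Suc.IH[OF this] show ?case
      unfolding funpow_Suc_right o_apply curve_derivativeI[OF d[OF Suc.prems]] .
  qed
  then show ?thesis by (simp add: smooth_curve_def)
qed

text \<open>
  The test function is the first Dirichlet eigenfunction of \<open>[-T, T]\<close>; its energy
  \<open>\<pi>\<^sup>2 / (4 T)\<close> tends to \<open>0\<close> as \<open>T\<close> grows.
\<close>

lemma nonneg_potential_zero_if_stable:
  fixes K :: "real \<Rightarrow> real"
  assumes cont: "continuous_on UNIV K" and nonneg: "\<And>t. K t \<ge> 0"
    and pos: "\<And>T. T > 0 \<Longrightarrow> integral {-T..T} (\<lambda>t. ((pi / (2*T))\<^sup>2 - 2 * K t) * (cos (pi / (2*T) * t))\<^sup>2) > 0"
  shows "K t0 = 0"
proof (rule ccontr)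
  assume "K t0 \<noteq> 0"
  then have K0: "K t0 > 0" using nonneg[of t0] by simp
  \<comment> \<open>Half the value at \<open>t0\<close> is a lower bound for \<open>K\<close> on the
    whole interval \<open>[u,v]\<close>, which has length \<delta>.\<close>
  define \<kappa> where "\<kappa> = K t0 / 2"
  have \<kappa>: "\<kappa> > 0" using K0 by (simp add: \<kappa>_def)
  from cont have "isCont K t0" by (simp add: continuous_on_eq_continuous_at)
  then obtain \<delta> where \<delta>: "\<delta> > 0" "\<And>t. \<bar>t - t0\<bar> < \<delta> \<Longrightarrow> \<bar>K t - K t0\<bar> < \<kappa>"
    using \<kappa> unfolding continuous_at_eps_delta dist_real_def by metis
  define u where "u = t0 - \<delta>/2"
  define v where "v = t0 + \<delta>/2"
  have K: "K t \<ge> \<kappa>" if "t \<in> {u..v}" for t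
  proof -
    have "\<bar>t - t0\<bar> < \<delta>" using that \<delta>(1) by (auto simp: u_def v_def)
    from \<delta>(2)[OF this] show ?thesis unfolding \<kappa>_def by linarith
  qed
  \<comment> \<open>The first bound gives \<open>\<bar>t\<bar> \<le> T/2\<close> on
    \<open>[u,v]\<close>, hence \<open>cos^2 \<ge> 1/2\<close> there; the second makes
    \<open>pi^2 / (2 T)\<close> at most \<open>\<kappa> \<delta>\<close>.\<close>
  define T where "T = max (2 * (\<bar>t0\<bar> + \<delta>)) (pi\<^sup>2 / (2 * \<delta> * \<kappa>))"
  have T: "T \<ge> 2 * (\<bar>t0\<bar> + \<delta>)" "T \<ge> pi\<^sup>2 / (2 * \<delta> * \<kappa>)" by (auto simp: T_def)
  have T0: "T > 0" using \<delta>(1) by (intro order.strict_trans2[OF _ T(1)]) (simp add: add_nonneg_pos)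
  define c where "c = pi / (2*T)"
  define F where "F = (\<lambda>t. (c\<^sup>2 - 2 * K t) * (cos (c * t))\<^sup>2)"
  have contF: "continuous_on A F" for A
    unfolding F_def by (intro continuous_intros continuous_on_subset[OF cont]) auto
  have F_le: "F t \<le> c\<^sup>2" for t
  proof -
    have "F t \<le> c\<^sup>2 * (cos (c * t))\<^sup>2" using nonneg[of t] by (simp add: F_def mult_right_mono)
    also have "\<dots> \<le> c\<^sup>2 * 1" by (intro mult_left_mono) (auto simp: abs_square_le_1)
    finally show ?thesis by simp
  qed
  have F_le': "F t \<le> c\<^sup>2 - \<kappa>" if t: "t \<in> {u..v}" for t
  proof -
    have "\<bar>t\<bar> \<le> T/2" using t T(1) \<delta>(1) by (auto simp: u_def v_def)
    then have "c * \<bar>t\<bar> \<le> c * (T/2)" using T0 by (intro mult_left_mono) (auto simp: c_def)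
    then have "\<bar>c * t\<bar> \<le> pi/4" using T0 by (simp add: c_def abs_mult)
    then have "cos (pi/4) \<le> cos \<bar>c * t\<bar>" by (intro cos_monotone_0_pi_le) auto
    then have "(cos (pi/4))\<^sup>2 \<le> (cos (c * t))\<^sup>2" by (intro power_mono) (auto simp: cos_45)
    then have h: "1/2 \<le> (cos (c * t))\<^sup>2" by (simp add: cos_45 power_divide)
    have "2 * \<kappa> * (1/2) \<le> 2 * K t * (cos (c * t))\<^sup>2"
      using K[OF t] \<kappa> h by (intro mult_mono) auto
    moreover have "c\<^sup>2 * (cos (c * t))\<^sup>2 \<le> c\<^sup>2 * 1" by (intro mult_left_mono) (auto simp: abs_square_le_1)
    ultimately show ?thesis by (simp add: F_def algebra_simps)
  qed
  have int: "F integrable_on {l..r}" for l r by (rule integrable_continuous_interval[OF contF])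
  have bound: "integral {l..r} F \<le> C * (r - l)" if "l \<le> r" "\<And>t. t \<in> {l..r} \<Longrightarrow> F t \<le> C" for l r C
    using integral_le[OF int integrable_const_ivl[of C l r] that(2)] that(1) by (simp add: mult.commute)
  have uv: "-T \<le> u" "u \<le> v" "v \<le> T" using T(1) \<delta>(1) by (auto simp: u_def v_def)
  have "integral {-T..T} F = integral {-T..u} F + integral {u..v} F + integral {v..T} F"
    using Henstock_Kurzweil_Integration.integral_combine[OF uv(1) order.trans[OF uv(2,3)] int]
      Henstock_Kurzweil_Integration.integral_combine[OF uv(2,3) int] by simp
  \<comment> \<open>The crude bound \<open>cos^2 \<le> 1\<close> on the energy costs a factor 2, for
    which the choice of \<open>T\<close> allows.\<close>
  also have "\<dots> \<le> c\<^sup>2 * (u - (-T)) + (c\<^sup>2 - \<kappa>) * (v - u) + c\<^sup>2 * (T - v)"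
    using uv by (intro add_mono bound F_le F_le') auto
  also have "\<dots> = c\<^sup>2 * (2 * T) - \<kappa> * \<delta>" by (simp add: u_def v_def field_simps)
  also have "c\<^sup>2 * (2 * T) = pi\<^sup>2 / (2 * T)" using T0 by (simp add: c_def power2_eq_square field_simps)
  also have "pi\<^sup>2 / (2 * T) \<le> \<kappa> * \<delta>"
    using T(2) T0 \<delta>(1) \<kappa> by (simp add: field_simps)
  finally show False using pos[OF T0] by (simp add: F_def c_def)
qed

section \<open>The rotated velocity as a variation field\<close>

context special_kaehler_manifold
begin

lemma sk_metric_scaleR: "sk_metric \<tau> x (r *\<^sub>R v) w = r * sk_metric \<tau> x v w"
  unfolding sk_metric_inner scaleR_eq_vector_smult vec.scale
  unfolding scaleR_eq_vector_smult[symmetric] by simp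

context
  fixes \<gamma> :: "real \<Rightarrow> 'a"
  assumes \<gamma>: "complete_geodesic a \<tau> \<gamma>"
begin

abbreviation (input) "p \<equiv> velocity a \<gamma>"

lemma smooth_velocity: "smooth_curve p"
  using \<gamma> by (simp add: complete_geodesic_def velocity_def smooth_curve_curve_derivative)

lemma unit_speed: "sk_metric \<tau> (\<gamma> t) (p t) (p t) = 1"
  using \<gamma> by (simp add: complete_geodesic_def)

lemma geodesic_equation: "sk_christoffel a \<tau> (\<gamma> t) (p t) (p t) = - curve_derivative p t"
  using \<gamma> by (simp add: complete_geodesic_def covariant_derivative_def eq_neg_iff_add_eq_0 add.commute)

text \<open>Complex linearity of the connection carries the geodesic equation over to
  \<open>\<i> p\<close>, so \<open>\<i> p\<close> is parallel and only the scalar coefficient is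
  differentiated.\<close>

lemma covariant_derivative_J_velocity:
  assumes h: "\<And>t. (h has_real_derivative h' t) (at t)"
  shows "covariant_derivative a \<tau> \<gamma> (\<lambda>t. (\<i> * of_real (h t)) *s p t) = (\<lambda>t. (\<i> * of_real (h' t)) *s p t)"
proof
  fix t
  have "((\<lambda>t. (\<i> * of_real (h t)) *s p t) has_vector_derivative
      (\<i> * of_real (h' t)) *s p t + (\<i> * of_real (h t)) *s curve_derivative p t) (at t)"
  proof -
    have "((\<lambda>t. h t *\<^sub>R (\<i> *s p t)) has_vector_derivative
        h t *\<^sub>R (\<i> *s curve_derivative p t) + h' t *\<^sub>R (\<i> *s p t)) (at t)"
      by (intro has_vector_derivative_scaleR h bounded_linear.has_vector_derivative[OF bounded_linear_vector_smult_right]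
            smooth_curve_has_vector_derivative smooth_velocity)
    then show ?thesis
      by (simp add: scaleR_eq_vector_smult mult.commute add.commute)
  qed
  then have "curve_derivative (\<lambda>t. (\<i> * of_real (h t)) *s p t) t =
      (\<i> * of_real (h' t)) *s p t + (\<i> * of_real (h t)) *s curve_derivative p t"
    by (simp add: curve_derivative_def vector_derivative_at)
  then show "covariant_derivative a \<tau> \<gamma> (\<lambda>t. (\<i> * of_real (h t)) *s p t) t = (\<i> * of_real (h' t)) *s p t"
    by (simp add: covariant_derivative_def sk_christoffel_smult_right geodesic_equation vector_smult_rneg)
qed

text \<open>Differentiating the cosine twice gives \<open>c^2\<close>. The curvature term is
  expressed by \<open>\<Gamma>(p,p)\<close>, which along a geodesic is \<open>- p'\<close>, so the
  potential is the squared acceleration in period coordinates.\<close>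

lemma second_variation_integrand:
  "sk_metric \<tau> (\<gamma> t) (jacobi_operator a \<tau> \<gamma> (\<lambda>t. (\<i> * of_real (cos (c * t))) *s p t) t)
     ((\<i> * of_real (cos (c * t))) *s p t) =
   (c\<^sup>2 - 2 * sk_metric \<tau> (\<gamma> t) (curve_derivative p t) (curve_derivative p t)) * (cos (c * t))\<^sup>2"
proof -
  define V where "V = (\<lambda>t. (\<i> * of_real (cos (c * t))) *s p t)"
  have "covariant_derivative a \<tau> \<gamma> V = (\<lambda>t. (\<i> * of_real (- c * sin (c * t))) *s p t)"
    unfolding V_def by (rule covariant_derivative_J_velocity) (auto intro!: derivative_eq_intros)
  moreover have "covariant_derivative a \<tau> \<gamma> (\<lambda>t. (\<i> * of_real (- c * sin (c * t))) *s p t) =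
      (\<lambda>t. (\<i> * of_real (- c * (c * cos (c * t)))) *s p t)"
    by (rule covariant_derivative_J_velocity) (auto intro!: derivative_eq_intros)
  moreover have "(\<i> * of_real (- c * (c * cos (c * t)))) *s p t = - (c\<^sup>2) *\<^sub>R V t"
    by (simp add: V_def scaleR_eq_vector_smult power2_eq_square mult_ac)
  ultimately have "jacobi_operator a \<tau> \<gamma> V t = (c\<^sup>2) *\<^sub>R V t - sk_curvature a \<tau> (\<gamma> t) (V t) (p t) (p t)"
    by (simp add: jacobi_operator_def)
  moreover have "sk_metric \<tau> (\<gamma> t) (V t) (V t) = (cos (c * t))\<^sup>2"
    using unit_speed[of t]
    by (simp add: V_def sk_metric_inner vec.scale inner_vector_smult norm_mult)
  moreover have "sk_metric \<tau> (\<gamma> t) (sk_curvature a \<tau> (\<gamma> t) (V t) (p t) (p t)) (V t) =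
     2 * (cos (c * t))\<^sup>2 * sk_metric \<tau> (\<gamma> t) (curve_derivative p t) (curve_derivative p t)"
    unfolding V_def sk_holomorphic_sectional_curvature geodesic_equation
    by (simp add: sk_metric_def)
  moreover have "sk_metric \<tau> (\<gamma> t) ((c\<^sup>2) *\<^sub>R V t - X) (V t) =
      c\<^sup>2 * sk_metric \<tau> (\<gamma> t) (V t) (V t) - sk_metric \<tau> (\<gamma> t) X (V t)" for X
    unfolding sk_metric_scaleR[symmetric]
    by (simp add: sk_metric_inner matrix_vector_mult_diff_distrib inner_diff_left)
  ultimately have "sk_metric \<tau> (\<gamma> t) (jacobi_operator a \<tau> \<gamma> V t) (V t) =
      (c\<^sup>2 - 2 * sk_metric \<tau> (\<gamma> t) (curve_derivative p t) (curve_derivative p t)) * (cos (c * t))\<^sup>2"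
    by (simp add: left_diff_distrib)
  then show ?thesis unfolding V_def .
qed

lemma J_velocity_normal_field:
  assumes "T > 0"
  shows "normal_field_vanishing_at a \<tau> \<gamma> (-T) T (\<lambda>t. (\<i> * of_real (cos (pi / (2*T) * t))) *s p t)"
proof -
  define c where "c = pi / (2*T)"
  have "c * T = pi / 2" using assms by (simp add: c_def)
  then have cT: "cos (c * T) = 0" by (metis cos_pi_half)
  \<comment> \<open>A zero sine coefficient brings the field into the form of the closure
    lemma.\<close>
  have "smooth_curve (\<lambda>t. cos (c * t) *\<^sub>R (\<i> *s p t) + sin (c * t) *\<^sub>R (0 *s p t))"
    by (intro smooth_curve_trigonometric_combination smooth_curve_bounded_linear[OF bounded_linear_vector_smult_right]
         smooth_velocity)
  then have "smooth_curve (\<lambda>t. (\<i> * of_real (cos (c * t))) *s p t)"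
    by (rule back_subst[of smooth_curve]) (simp add: scaleR_eq_vector_smult mult.commute)
  \<comment> \<open>Normality: the Hermitian form of \<open>p u\<close> with itself is real, so its
    multiple by \<open>\<i> s\<close> has real part 0.\<close>
  moreover have "sk_metric \<tau> (\<gamma> u) ((\<i> * of_real s) *s p u) (p u) = 0" for u s
  proof -
    define q where "q = im_matrix (\<tau> (\<gamma> u)) *v p u"
    have "Im (bilinear_dot q (cnj_vec (p u))) = 0"
      unfolding q_def by (rule im_matrix_hermitian) (rule \<tau>_symmetric)
    then show ?thesis
      by (simp add: sk_metric_inner vec.scale inner_complex_vec bilinear_dot_def q_def[symmetric] cnj_vec_def
          mult.assoc flip: sum_distrib_left)
  qed
  ultimately show ?thesis
    using cT by (simp add: normal_field_vanishing_at_def c_def[symmetric])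
qed

lemma continuous_on_geodesic_metric:
  assumes V: "continuous_on UNIV V"
  shows "continuous_on UNIV (\<lambda>t. sk_metric \<tau> (\<gamma> t) (V t) (V t))"
proof -
  have c\<gamma>: "continuous_on UNIV \<gamma>" using \<gamma> by (simp add: complete_geodesic_def)
  have "continuous_on UNIV (\<lambda>t. \<tau> (\<gamma> t) $ i $ j)" for i j
    by (rule continuous_on_compose2[OF continuous_on_\<tau> c\<gamma>]) auto
  then have "continuous_on UNIV (\<lambda>t. complex_of_real (Im (\<tau> (\<gamma> t) $ i $ j)))" for i j
    by (intro continuous_on_of_real continuous_on_Im)
  then show ?thesis
    unfolding sk_metric_def
    by (intro continuous_on_Re continuous_on_sum continuous_on_mult continuous_on_cnj continuous_on_component V)
qed

end

section \<open>Straightness of stable geodesics and its consequences\<close>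

theorem stable_geodesic_affine:
  assumes \<gamma>: "stable_geodesic a \<tau> \<gamma>"
  obtains v where "\<And>s t. a (\<gamma> t) = a (\<gamma> s) + (t - s) *\<^sub>R v" "\<And>t. sk_metric \<tau> (\<gamma> t) v v = 1"
proof -
  define p where "p = velocity a \<gamma>"
  have g: "complete_geodesic a \<tau> \<gamma>" using \<gamma> by (simp add: stable_geodesic_def)
  define K where "K = (\<lambda>t. sk_metric \<tau> (\<gamma> t) (curve_derivative p t) (curve_derivative p t))"
  have smooth: "smooth_curve p" unfolding p_def by (rule smooth_velocity[OF g])
  have dp: "(p has_vector_derivative curve_derivative p t) (at t)" for t
    by (rule smooth_curve_has_vector_derivative[OF smooth])
  have K_nonneg: "K t \<ge> 0" for t
    using sk_metric_pos[of "curve_derivative p t" "\<gamma> t"]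
    by (cases "curve_derivative p t = 0") (auto simp: K_def sk_metric_inner less_imp_le)
  have "K t = 0" for t
  proof (rule nonneg_potential_zero_if_stable[OF _ K_nonneg])
    have "continuous_on UNIV (curve_derivative p)"
      using smooth_curve_has_vector_derivative[OF smooth_curve_curve_derivative[OF smooth]]
      by (intro continuous_at_imp_continuous_on ballI has_vector_derivative_continuous) 
    then show "continuous_on UNIV K"
      unfolding K_def by (rule continuous_on_geodesic_metric[OF g])
  next
    fix T :: real assume T: "T > 0"
    define V where "V = (\<lambda>t. (\<i> * of_real (cos (pi / (2*T) * t))) *s p t)"
    have "normal_field_vanishing_at a \<tau> \<gamma> (-T) T V"
      unfolding V_def p_def by (rule J_velocity_normal_field[OF g T])
    \<comment> \<open>The cosine is 1 at 0 and unit speed excludes \<open>p 0 = 0\<close>, so the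
      test field is admissible in \<open>stable_between\<close>.\<close>
    moreover have "V 0 \<noteq> 0"
      using unit_speed[OF g, of 0] by (auto simp: V_def p_def sk_metric_inner)
    then have "\<exists>u\<in>{-T..T}. V u \<noteq> 0" using T by (intro bexI[of _ 0]) auto
    moreover have "stable_between a \<tau> \<gamma> (-T) T"
      using \<gamma> T by (simp add: stable_geodesic_def)
    ultimately have "integral {-T..T} (\<lambda>u. sk_metric \<tau> (\<gamma> u) (jacobi_operator a \<tau> \<gamma> V u) (V u)) > 0"
      unfolding stable_between_def by blast
    then show "integral {-T..T} (\<lambda>t. ((pi / (2*T))\<^sup>2 - 2 * K t) * (cos (pi / (2*T) * t))\<^sup>2) > 0"
      unfolding V_def p_def second_variation_integrand[OF g] K_def .
  qed
  \<comment> \<open>Positive definiteness turns \<open>K = 0\<close> into vanishing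
    acceleration.\<close>
  then have p0: "curve_derivative p t = 0" for t
    using sk_metric_pos[of "curve_derivative p t" "\<gamma> t"] by (force simp: K_def)
  have "(p has_derivative (\<lambda>h. 0)) (at t within UNIV)" for t
    using dp[of t] by (simp add: p0 has_vector_derivative_def)
  then obtain k where "\<And>t. p t = k" using has_derivative_zero_constant[of UNIV p] by auto
  then have p_const: "p t = p 0" for t by simp
  have da: "((a \<circ> \<gamma>) has_vector_derivative p 0) (at t)" for t
    using smooth_curve_has_vector_derivative[of "a \<circ> \<gamma>" t] g p_const[of t]
    by (simp add: complete_geodesic_def p_def velocity_def)
  have "((\<lambda>t. (a \<circ> \<gamma>) t - t *\<^sub>R p 0) has_derivative (\<lambda>h. 0)) (at t within UNIV)" for t
    using da[of t] by (auto intro!: derivative_eq_intros simp: has_vector_derivative_def o_def)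
  then obtain k where "\<And>t. (a \<circ> \<gamma>) t - t *\<^sub>R p 0 = k"
    using has_derivative_zero_constant[of UNIV "\<lambda>t. (a \<circ> \<gamma>) t - t *\<^sub>R p 0"] by auto
  then have "a (\<gamma> t) = k + t *\<^sub>R p 0" for t by (metis comp_apply diff_add_cancel add.commute)
  moreover have "sk_metric \<tau> (\<gamma> t) (p 0) (p 0) = 1" for t
    using unit_speed[OF g, of t] p_const[of t] by (simp add: p_def)
  ultimately show thesis by (intro that[of "p 0"]) (simp_all add: algebra_simps)
qed

text \<open>Subtracting the affine formulas at the two meeting points gives \<open>v = k w\<close>.
  At the first meeting point both unit norms use the same inner product, so \<open>k\<close> is 1 or
  -1, the latter for opposite orientations.\<close>

theorem stable_geodesics_meeting_twice:
  assumes \<gamma>: "stable_geodesic a \<tau> \<gamma>" and \<delta>: "stable_geodesic a \<tau> \<delta>"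
    and p: "\<gamma> t = \<delta> s" and q: "\<gamma> t' = \<delta> s'" and neq: "\<gamma> t \<noteq> \<gamma> t'"
  shows "range \<gamma> = range \<delta>"
proof -
  obtain v where v: "\<And>s t. a (\<gamma> t) = a (\<gamma> s) + (t - s) *\<^sub>R v" "\<And>t. sk_metric \<tau> (\<gamma> t) v v = 1"
    by (rule stable_geodesic_affine[OF \<gamma>]) blast
  obtain w where w: "\<And>s t. a (\<delta> t) = a (\<delta> s) + (t - s) *\<^sub>R w" "\<And>t. sk_metric \<tau> (\<delta> t) w w = 1"
    by (rule stable_geodesic_affine[OF \<delta>]) blast
  have t: "t' - t \<noteq> 0" using neq by auto
  define k where "k = (s' - s) / (t' - t)"
  have "(t' - t) *\<^sub>R v = (s' - s) *\<^sub>R w"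
    using v(1)[of t' t] w(1)[of s' s] p q by simp
  then have "(1 / (t' - t)) *\<^sub>R ((t' - t) *\<^sub>R v) = (1 / (t' - t)) *\<^sub>R ((s' - s) *\<^sub>R w)" by simp
  then have vw: "v = k *\<^sub>R w" using t by (simp add: k_def)
  have "k * (k * sk_metric \<tau> (\<delta> s) w w) = sk_metric \<tau> (\<gamma> t) v v"
    by (simp add: vw p sk_metric_scaleR) (simp add: sk_metric_inner)
  then have "k\<^sup>2 = 1" by (simp add: v(2) w(2) power2_eq_square)
  then have k: "k * k = 1" by (simp add: power2_eq_square)
  have c: "continuous_on UNIV \<gamma>" "continuous_on UNIV \<delta>"
    using \<gamma> \<delta> by (auto simp: stable_geodesic_def complete_geodesic_def)
  have eq: "\<gamma> = (\<lambda>x. \<delta> (s + k * (x - t)))"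
  proof (rule curve_determined_by_periods[of _ _ t])
    show "continuous_on UNIV (\<lambda>x. \<delta> (s + k * (x - t)))"
      by (rule continuous_on_compose2[OF c(2)]) (auto intro!: continuous_intros)
    show "a (\<gamma> x) = a (\<delta> (s + k * (x - t)))" for x
      using v(1)[of x t] w(1)[of "s + k * (x - t)" s] by (simp add: vw p mult.commute)
  qed (use c p in auto)
  \<comment> \<open>Since \<open>k\<close> is its own inverse, the substitution is inverted by
    exchanging the roles of \<open>s\<close> and \<open>t\<close>; this yields the other inclusion
    of images.\<close>
  have "\<delta> x = \<gamma> (t + k * (x - s))" for x
    by (subst eq) (simp add: k flip: mult.assoc)
  then show ?thesis using eq by (metis (no_types) rangeI image_subsetI subset_antisym)
qed

theorem stable_geodesic_not_closed:
  assumes "stable_geodesic a \<tau> \<gamma>"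
  shows "\<not> closed_geodesic a \<tau> \<gamma>"
proof
  obtain v where v: "\<And>s t. a (\<gamma> t) = a (\<gamma> s) + (t - s) *\<^sub>R v" "\<And>t. sk_metric \<tau> (\<gamma> t) v v = 1"
    by (rule stable_geodesic_affine[OF assms]) blast
  assume "closed_geodesic a \<tau> \<gamma>"
  then obtain L where "L > 0" "\<gamma> (0 + L) = \<gamma> 0" unfolding closed_geodesic_def by blast
  \<comment> \<open>Over one period the affine formula gives \<open>L v = 0\<close>, contradicting
    unit speed.\<close>
  with v(1)[of L 0] have "v = 0" by simp
  with v(2)[of 0] show False by (simp add: sk_metric_inner)
qed

end

theorem proposition1:
  fixes atlas :: "('a::{t2_space, second_countable_topology}, 'r::finite) chart set"
    and a b :: "'a \<Rightarrow> complex ^ 'r"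
    and \<tau> :: "'a \<Rightarrow> complex ^ 'r ^ 'r"
  assumes "special_kaehler_manifold atlas a b \<tau>"
    and "simply_connected (UNIV :: 'a set)"
  shows "(\<forall>\<gamma> \<delta>. stable_geodesic a \<tau> \<gamma> \<and> stable_geodesic a \<tau> \<delta> \<and> range \<gamma> \<noteq> range \<delta> \<longrightarrow>
            (\<forall>p \<in> range \<gamma> \<inter> range \<delta>. \<forall>q \<in> range \<gamma> \<inter> range \<delta>. p = q))
       \<and> \<not> (\<exists>\<gamma>. stable_geodesic a \<tau> \<gamma> \<and> closed_geodesic a \<tau> \<gamma>)"
proof -
  interpret special_kaehler_manifold atlas a b \<tau> by (rule assms(1))
  \<comment> \<open>Two distinct common points would force equal images.\<close>
  show ?thesis
    using stable_geodesics_meeting_twice stable_geodesic_not_closed by (blast elim: rangeE)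
qed

end
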